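(* Let $q$ be a prime power, $S=\mathbb{F}_q[x,y]$, and let $B\subset GL_2(\mathbb{F}_q)$ be the Borel subgroup of upper triangular matrices. One has a direct sum decomposition $S_B=M_1'\oplus M_2'$ as modules for $S^B=\mathbb{F}_q[D_{2,1},X]$, where - $M_1'$ is a free $\mathbb{F}_q[D_{2,1},X]$-module on $\{Y\}$, and - $M_2'$ is a direct sum of copies of the quotient $S^B$-module $\mathbb{F}_q[D_{2,1},X]/(X)$, with basis $\{1,\ Y^2-XY,\ Y^3-X^2Y,\ \dots,\ Y^{q-1}-X^{q-2}Y\}$. In particular, $$\mathrm{Hilb}(S_B,t)=\frac{t^{q-1}}{(1-t^{q-1})(1-t^{q^2-q})}+\frac{1+t^{2(q-1)}+t^{3(q-1)}+\cdots+t^{(q-1)^2}}{1-t^{q^2-q}},$$ which equals $$1+\frac{t^{q-1}}{1-t^{q-1}}+\frac{t^{2(q-1)}}{1-t^{q-1}}+\frac{t^{q^2+q-2}}{(1-t^{q-1})(1-t^{q^2-q})}.$$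
   Context: $S$ has the standard grading. A matrix $g=\begin{bmatrix}a&b\\0&d\end{bmatrix}\in B$ acts on $S$ by the algebra automorphism $x\mapsto ax$, $y\mapsto bx+dy$. $X:=x^{q-1}$, $Y:=y^{q-1}$, $D_{2,1}:=Y^q+XY^{q-1}+\cdots+X^{q-1}Y+X^q$. It is known that $S^B=\mathbb{F}_q[X,D_{2,1}]$, a polynomial algebra. The $B$-cofixed space is $S_B=S/N$, where $N$ is the $\mathbb{F}_q$-span of all $g(f)-f$ with $g\in B$, $f\in S$; it is a graded $S^B$-module, and elements of $S$ are identified with their images in $S_B$. The listed basis of $M_2'$ consists of $1$ and $Y^j-X^{j-1}Y$ for $2\le j\le q-1$, and correspondingly the numerator $1+t^{2(q-1)}+\cdots+t^{(q-1)^2}$ means $1+\sum_{j=2}^{q-1}t^{j(q-1)}$ (both reduce to the term $1$ when $q=2$). $\mathrm{Hilb}(U,t)=\sum_d\dim_{\mathbb{F}_q}(U_d)t^d$. *)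

theory Defs
  imports "HOL-Analysis.Analysis" "HOL-Computational_Algebra.Primes"
begin

text \<open>
  The field \<open>\<bbbF>\<^sub>q\<close> is a type \<open>'a\<close> of class \<^class>\<open>finite_field\<close> with \<open>q = CARD('a)\<close>.
  The ring \<open>S = \<bbbF>\<^sub>q[x, y]\<close> is \<open>'a poly poly\<close>, read as \<open>\<bbbF>\<^sub>q[x][y]\<close>: the inner variable is \<open>x\<close>, the
  outer one is \<open>y\<close>, and the coefficient of \<open>x\<^sup>i y\<^sup>j\<close> in \<open>f\<close> is \<open>coeff (coeff f j) i\<close>.
\<close>

section \<open>The polynomial ring in two variables\<close>

definition const :: "'a::comm_ring_1 \<Rightarrow> 'a poly poly"
  where "const c = [:[:c:]:]"

definition var_x :: "'a::comm_ring_1 poly poly"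
  where "var_x = [:[:0, 1:]:]"

definition var_y :: "'a::comm_ring_1 poly poly"
  where "var_y = [:0, 1:]"

definition homogeneous :: "nat \<Rightarrow> 'a::comm_ring_1 poly poly set"
  where "homogeneous d = {f. \<forall>i j. coeff (coeff f j) i \<noteq> 0 \<longrightarrow> i + j = d}"

text \<open>\<open>subst2 u v\<close> is the algebra endomorphism of \<open>S\<close> with \<open>x \<mapsto> u\<close> and \<open>y \<mapsto> v\<close>.\<close>

definition subst2 ::
  "'a::comm_ring_1 poly poly \<Rightarrow> 'a poly poly \<Rightarrow> 'a poly poly \<Rightarrow> 'a poly poly"
  where "subst2 u v f = poly (map_poly (\<lambda>p. poly (map_poly const p) u) f) v"

lemma const_0 [simp]: "const 0 = 0"
  and const_1 [simp]: "const 1 = 1"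
  and const_add: "const (a + b) = const a + const b"
  and const_mult: "const (a * b) = const a * const b"
  by (simp_all add: const_def one_pCons)

lemma const_power: "const (a ^ n) = const a ^ n"
  by (induction n) (simp_all add: const_mult)

context
  fixes h :: "'a::comm_ring_1 \<Rightarrow> 'b::comm_ring_1"
  assumes h0: "h 0 = 0"
    and h_add: "\<And>a b. h (a + b) = h a + h b"
    and h_mult: "\<And>a b. h (a * b) = h a * h b"
begin

lemma eval_hom_pCons:
  "poly (map_poly h (pCons a p)) v = h a + v * poly (map_poly h p) v"
  by (cases "a = 0 \<and> p = 0") (auto simp: map_poly_pCons h0)

lemma eval_hom_add:
  "poly (map_poly h (p + r)) v = poly (map_poly h p) v + poly (map_poly h r) v"
  by (induction p r rule: poly_induct2) (simp_all add: eval_hom_pCons h_add algebra_simps)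

lemma eval_hom_smult:
  "poly (map_poly h (smult a r)) v = h a * poly (map_poly h r) v"
  by (induction r) (simp_all add: eval_hom_pCons h_mult algebra_simps)

lemma eval_hom_mult:
  "poly (map_poly h (p * r)) v = poly (map_poly h p) v * poly (map_poly h r) v"
  by (induction p)
    (simp_all add: eval_hom_add eval_hom_pCons eval_hom_smult h0 algebra_simps)

end

lemma subst2_const [simp]: "subst2 u v (const c) = const c"
  unfolding subst2_def by (cases "c = 0") (simp_all add: const_def map_poly_pCons)

lemma subst2_var_x [simp]: "subst2 u v var_x = u"
  by (simp add: subst2_def var_x_def map_poly_pCons)

lemma subst2_var_y [simp]: "subst2 u v var_y = v"
  by (simp add: subst2_def var_y_def map_poly_pCons)

lemma subst2_add: "subst2 u v (f + g) = subst2 u v f + subst2 u v g"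
  unfolding subst2_def
  by (rule eval_hom_add) (simp_all add: eval_hom_add eval_hom_mult const_add const_mult)

lemma subst2_mult: "subst2 u v (f * g) = subst2 u v f * subst2 u v g"
  unfolding subst2_def
  by (rule eval_hom_mult) (simp_all add: eval_hom_add eval_hom_mult const_add const_mult)

lemma subst2_0 [simp]: "subst2 u v 0 = 0"
  by (simp add: subst2_def)

lemma subst2_1 [simp]: "subst2 u v 1 = 1"
  using subst2_const[of u v 1] by simp

lemma subst2_uminus: "subst2 u v (- f) = - subst2 u v f"
  using subst2_add[of u v f "- f"] by (simp add: eq_neg_iff_add_eq_0 add.commute)

lemma subst2_diff: "subst2 u v (f - g) = subst2 u v f - subst2 u v g"
  using subst2_add[of u v f "- g"] by (simp add: subst2_uminus)

lemma subst2_power: "subst2 u v (f ^ n) = subst2 u v f ^ n"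
  by (induction n) (simp_all add: subst2_mult)

global_interpretation S: vector_space "\<lambda>(c::'a::field) (f::'a poly poly). const c * f"
  by unfold_locales (simp_all add: const_add const_mult algebra_simps)


section \<open>The Borel subgroup and its invariants\<close>

definition borel_group :: "('a::field ^ 2 ^ 2) set"
  where "borel_group = {g. invertible g \<and> g $ 2 $ 1 = 0}"

definition act :: "'a::field ^ 2 ^ 2 \<Rightarrow> 'a poly poly \<Rightarrow> 'a poly poly"
  where "act g = subst2 (const (g $ 1 $ 1) * var_x)
                        (const (g $ 1 $ 2) * var_x + const (g $ 2 $ 2) * var_y)"

definition poly_X :: "'a::finite_field poly poly"
  where "poly_X = var_x ^ (CARD('a) - 1)"

definition poly_Y :: "'a::finite_field poly poly"
  where "poly_Y = var_y ^ (CARD('a) - 1)"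

definition poly_D :: "'a::finite_field poly poly"
  where "poly_D = (\<Sum>i\<le>CARD('a). poly_X ^ i * poly_Y ^ (CARD('a) - i))"

definition invariants :: "'a::finite_field poly poly set"
  where "invariants = {f. \<forall>g\<in>borel_group. act g f = f}"

lemma poly_X_invariant: "(poly_X :: 'a::finite_field poly poly) \<in> invariants"
  unfolding invariants_def
proof safe
  fix g :: "'a ^ 2 ^ 2"
  assume "g \<in> borel_group"
  then have "g $ 1 $ 1 \<noteq> 0"
    by (auto simp: borel_group_def invertible_det_nz det_2)
  moreover have "g $ 1 $ 1 * g $ 1 $ 1 ^ (CARD('a) - 1) = g $ 1 $ 1"
    using finite_field_power_card_eq_same[of "g $ 1 $ 1"]
    by (metis power_eq_if zero_less_card_finite less_numeral_extra(3))
  ultimately have "g $ 1 $ 1 ^ (CARD('a) - 1) = 1"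
    by simp
  then show "act g poly_X = poly_X"
    by (simp add: act_def poly_X_def subst2_power power_mult_distrib flip: const_power)
qed

text \<open>The ring \<open>S\<^sup>B\<close> as a type, so that the library's module theory applies to it.\<close>

typedef (overloaded) 'a inv_ring = "invariants :: 'a::finite_field poly poly set"
  morphisms poly_of Abs_inv_ring
  by (rule exI[of _ poly_X]) (rule poly_X_invariant)

setup_lifting type_definition_inv_ring

instantiation inv_ring :: (finite_field) comm_ring_1
begin

lift_definition zero_inv_ring :: "'a inv_ring" is 0
  by (simp add: invariants_def act_def)
lift_definition one_inv_ring :: "'a inv_ring" is 1
  by (simp add: invariants_def act_def)
lift_definition plus_inv_ring :: "'a inv_ring \<Rightarrow> 'a inv_ring \<Rightarrow> 'a inv_ring" is "(+)"
  by (simp add: invariants_def act_def subst2_add)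
lift_definition minus_inv_ring :: "'a inv_ring \<Rightarrow> 'a inv_ring \<Rightarrow> 'a inv_ring" is "(-)"
  by (simp add: invariants_def act_def subst2_diff)
lift_definition uminus_inv_ring :: "'a inv_ring \<Rightarrow> 'a inv_ring" is uminus
  by (simp add: invariants_def act_def subst2_uminus)
lift_definition times_inv_ring :: "'a inv_ring \<Rightarrow> 'a inv_ring \<Rightarrow> 'a inv_ring" is "(*)"
  by (simp add: invariants_def act_def subst2_mult)

instance
  by standard (transfer; simp add: algebra_simps)+

end

lift_definition inv_X :: "'a::finite_field inv_ring" is poly_X
  by (rule poly_X_invariant)


section \<open>The cofixed space\<close>

definition cofixed_relations :: "'a::finite_field poly poly set"
  where "cofixed_relations = S.span {act g f - f | g f. g \<in> borel_group}"

lemma cofixed_relations_eq: "f = g \<Longrightarrow> f - g \<in> cofixed_relations"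
  by (simp add: cofixed_relations_def S.span_zero)

lemma cofixed_relations_add:
  "f \<in> cofixed_relations \<Longrightarrow> g \<in> cofixed_relations \<Longrightarrow> f + g \<in> cofixed_relations"
  unfolding cofixed_relations_def by (rule S.span_add)

lemma cofixed_relations_uminus: "f \<in> cofixed_relations \<Longrightarrow> - f \<in> cofixed_relations"
  unfolding cofixed_relations_def by (rule S.span_neg)

lemma cofixed_relations_const:
  "f \<in> cofixed_relations \<Longrightarrow> const c * f \<in> cofixed_relations"
  unfolding cofixed_relations_def by (rule S.span_scale)

lemma cofixed_relations_invariant:
  assumes "r \<in> invariants" "f \<in> cofixed_relations"
  shows "r * f \<in> cofixed_relations"
  using assms(2) unfolding cofixed_relations_def
proof (induction rule: S.span_induct_alt)
  case base
  then show ?case by (simp add: S.span_zero)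
next
  case (step c e f)
  then obtain g h where g: "g \<in> borel_group" "e = act g h - h"
    by auto
  moreover have "act g (r * h) = act g r * act g h"
    by (simp only: act_def subst2_mult)
  moreover have "act g r = r"
    using assms(1) g(1) by (simp add: invariants_def)
  ultimately have "r * e = act g (r * h) - r * h"
    by (simp only: right_diff_distrib)
  then have "r * e \<in> S.span {act g f - f | g f. g \<in> borel_group}"
    using g(1) by (auto intro!: S.span_base)
  then have "const c * (r * e) + r * f \<in> S.span {act g f - f | g f. g \<in> borel_group}"
    using step by (intro S.span_add S.span_scale)
  then show ?case
    by (simp add: algebra_simps)
qed

quotient_type (overloaded) 'a cofixed = "'a::finite_field poly poly" / "\<lambda>f g. f - g \<in> cofixed_relations"
  morphisms rep_cofixed cofixed_class
proof (rule equivpI)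
  show "reflp (\<lambda>f g :: 'a poly poly. f - g \<in> cofixed_relations)"
    by (simp add: reflp_def cofixed_relations_def S.span_zero)
  show "symp (\<lambda>f g :: 'a poly poly. f - g \<in> cofixed_relations)"
    unfolding symp_def by (metis cofixed_relations_uminus minus_diff_eq)
  show "transp (\<lambda>f g :: 'a poly poly. f - g \<in> cofixed_relations)"
    unfolding transp_def
  proof (intro allI impI)
    fix f g h :: "'a poly poly"
    assume "f - g \<in> cofixed_relations" "g - h \<in> cofixed_relations"
    then have "(f - g) + (g - h) \<in> cofixed_relations"
      by (rule cofixed_relations_add)
    then show "f - h \<in> cofixed_relations"
      by simp
  qed
qed

instantiation cofixed :: (finite_field) ab_group_add
begin

lift_definition zero_cofixed :: "'a cofixed" is 0 .
lift_definition plus_cofixed :: "'a cofixed \<Rightarrow> 'a cofixed \<Rightarrow> 'a cofixed" is "(+)"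
  by (metis cofixed_relations_add add_diff_add)
lift_definition uminus_cofixed :: "'a cofixed \<Rightarrow> 'a cofixed" is uminus
  by (metis cofixed_relations_uminus minus_diff_minus)
definition minus_cofixed :: "'a cofixed \<Rightarrow> 'a cofixed \<Rightarrow> 'a cofixed"
  where "minus_cofixed u v = u + (- v)"

instance
proof
  fix u v w :: "'a cofixed"
  show "u + v + w = u + (v + w)"
    by transfer (rule cofixed_relations_eq, rule add.assoc)
  show "u + v = v + u"
    by transfer (rule cofixed_relations_eq, rule add.commute)
  show "0 + u = u"
    by transfer (rule cofixed_relations_eq, rule add_0_left)
  show "- u + u = 0"
    by transfer (rule cofixed_relations_eq, rule left_minus)
  show "u - v = u + - v"
    by (rule minus_cofixed_def)
qed

end

lift_definition cofixed_scale :: "'a::finite_field inv_ring \<Rightarrow> 'a cofixed \<Rightarrow> 'a cofixed" is "(*)"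
  by (metis cofixed_relations_invariant right_diff_distrib)

lift_definition cofixed_field_scale :: "'a::finite_field \<Rightarrow> 'a cofixed \<Rightarrow> 'a cofixed"
  is "\<lambda>c f. const c * f"
  by (metis cofixed_relations_const right_diff_distrib)

global_interpretation cofixed: module "cofixed_scale :: 'a::finite_field inv_ring \<Rightarrow> _"
  by standard
    (transfer; rule cofixed_relations_eq; simp only: distrib_left distrib_right mult.assoc mult_1_left)+

global_interpretation cofixed_field: vector_space "cofixed_field_scale :: 'a::finite_field \<Rightarrow> _"
  by standard
    (transfer; rule cofixed_relations_eq;
      simp only: const_add const_mult const_1 distrib_left distrib_right mult.assoc mult_1_left)+


section \<open>The quotient module \<open>S\<^sup>B / (X)\<close>\<close>

(* from here on, transfer should stop at elements of inv_ring *)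
lifting_forget inv_ring.lifting

quotient_type (overloaded) 'a inv_mod_X = "'a::finite_field inv_ring" / "\<lambda>r s. inv_X dvd r - s"
  morphisms rep_inv_mod_X inv_mod_X_class
proof (rule equivpI)
  show "reflp (\<lambda>r s :: 'a inv_ring. inv_X dvd r - s)"
    by (simp add: reflp_def)
  show "symp (\<lambda>r s :: 'a inv_ring. inv_X dvd r - s)"
    unfolding symp_def by (metis dvd_minus_iff minus_diff_eq)
  show "transp (\<lambda>r s :: 'a inv_ring. inv_X dvd r - s)"
    unfolding transp_def using dvd_add by fastforce
qed

instantiation inv_mod_X :: (finite_field) ab_group_add
begin

lift_definition zero_inv_mod_X :: "'a inv_mod_X" is 0 .
lift_definition plus_inv_mod_X :: "'a inv_mod_X \<Rightarrow> 'a inv_mod_X \<Rightarrow> 'a inv_mod_X" is "(+)"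
  by (metis add_diff_add dvd_add)
lift_definition uminus_inv_mod_X :: "'a inv_mod_X \<Rightarrow> 'a inv_mod_X" is uminus
  by (metis dvd_minus_iff minus_diff_minus)
definition minus_inv_mod_X :: "'a inv_mod_X \<Rightarrow> 'a inv_mod_X \<Rightarrow> 'a inv_mod_X"
  where "minus_inv_mod_X u v = u + (- v)"

instance
  by standard (unfold minus_inv_mod_X_def, (transfer; simp add: algebra_simps)+)

end

lift_definition inv_mod_X_scale :: "'a::finite_field inv_ring \<Rightarrow> 'a inv_mod_X \<Rightarrow> 'a inv_mod_X"
  is "(*)"
  by (metis dvd_mult right_diff_distrib)

global_interpretation inv_mod_X: module "inv_mod_X_scale :: 'a::finite_field inv_ring \<Rightarrow> _"
  by standard (transfer; simp add: algebra_simps)+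


section \<open>Direct sums and Hilbert series\<close>

text \<open>\<open>V\<close> is the internal direct sum of the finite family \<open>U\<close>: every element of \<open>V\<close> is
  \<open>\<Sum>j\<in>J. u j\<close> for exactly one choice of \<open>u j \<in> U j\<close>.\<close>

definition direct_sum :: "'i set \<Rightarrow> ('i \<Rightarrow> 'b::ab_group_add set) \<Rightarrow> 'b set \<Rightarrow> bool"
  where "direct_sum J U V \<longleftrightarrow>
    finite J \<and> bij_betw (\<lambda>u. \<Sum>j\<in>J. u j) (\<Pi>\<^sub>E j\<in>J. U j) V"

definition cofixed_piece :: "nat \<Rightarrow> 'a::finite_field cofixed set"
  where "cofixed_piece d = cofixed_class ` homogeneous d"

definition Hilb :: "(nat \<Rightarrow> 'a::finite_field cofixed set) \<Rightarrow> rat fps"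
  where "Hilb U = Abs_fps (\<lambda>d. of_nat (cofixed_field.dim (U d)))"

text \<open>The generators of the torsion summand, indexed by their degree divided by \<open>q - 1\<close>, so that
  the index set is \<open>{0} \<union> {2..q-1}\<close>.\<close>

definition torsion_gen :: "nat \<Rightarrow> 'a::finite_field poly poly"
  where "torsion_gen j = (if j = 0 then 1 else poly_Y ^ j - poly_X ^ (j - 1) * poly_Y)"

end

theory Submission
  imports Defs
begin

text \<open>
  The invariants of the unipotent subgroup are \<open>\<bbbF>\<^sub>q[x, P]\<close> with \<open>P = y\<^sup>q - x\<^bsup>q-1\<^esup> y\<close>: an invariant minus its
  value at \<open>y = 0\<close> vanishes on all lines \<open>y = c x\<close>, hence is divisible by \<open>P\<close>.  Restricting to torus
  invariants and using \<open>D = P\<^bsup>q-1\<^esup> + X\<^sup>q\<close> gives \<open>S\<^sup>B = \<bbbF>\<^sub>q[X, D]\<close>.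

  The transfer \<open>Tr f = \<Sum>\<^bsub>g\<in>B\<^esub> g f\<close> factors through the cofixed space, takes values in \<open>X S\<^sup>B\<close> and maps \<open>Y\<close>
  to \<open>-X\<close>.  So \<open>Y\<close> spans a free summand with complement \<open>M\<^sub>2 = ker Tr\<close>.  Moreover
  \<open>X f = - Tr(Y) f \<equiv> - Tr(f) Y\<close> modulo the cofixed relations, so \<open>X\<close> annihilates \<open>M\<^sub>2\<close>.  Finally
  \<open>f \<mapsto> f(0, y)\<close> followed by the projection to \<open>\<bbbF>\<^sub>q[Y]\<close> also factors through the cofixed space; it sends
  \<open>X\<close> to \<open>0\<close>, \<open>D\<close> to \<open>Y\<^sup>q\<close> and the \<open>j\<close>-th torsion generator to \<open>Y\<^sup>j\<close>, which separates the generators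
  of \<open>M\<^sub>2\<close> over \<open>\<bbbF>\<^sub>q[D]\<close>.
\<close>

section \<open>Finite fields and bivariate polynomials\<close>

lemma one_less_card_field: "1 < CARD('a::finite_field)"
proof -
  have "card {0, 1 :: 'a} \<le> CARD('a)"
    by (rule card_mono) auto
  then show ?thesis by simp
qed

text \<open>Translation by 1 permutes the field, so the sum of all elements equals itself plus
  \<open>CARD('a)\<close> copies of 1.\<close>

lemma of_nat_card_field: "of_nat CARD('a) = (0 :: 'a::finite_field)"
proof -
  have "(\<Sum>b\<in>UNIV. b + 1) = (\<Sum>b\<in>(UNIV :: 'a set). b)"
    by (rule sum.reindex_bij_betw[of "\<lambda>b. b + 1"])
      (auto simp: bij_betw_def inj_on_def intro: range_eqI[of _ _ "b - 1" for b])
  then show ?thesis by (simp add: sum.distrib)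
qed

lemma power_card_minus_one:
  fixes a :: "'a::finite_field"
  assumes "a \<noteq> 0"
  shows "a ^ (CARD('a) - 1) = 1"
proof -
  have "a * a ^ (CARD('a) - 1) = a"
    using finite_field_power_card_eq_same[of a] by (simp flip: power_Suc)
  with assms show ?thesis by simp
qed

text \<open>No primitive element is used: after reducing the exponent to its remainder r modulo q -
  1, a positive r would give a nonzero polynomial of degree r < q - 1 with all q - 1 units as
  roots.\<close>

lemma power_eq_one_iff_card_minus_one_dvd:
  "(\<forall>a :: 'a::finite_field. a \<noteq> 0 \<longrightarrow> a ^ n = 1) \<longleftrightarrow> (CARD('a) - 1) dvd n"
proof
  assume "(CARD('a) - 1) dvd n"
  then obtain k where "n = (CARD('a) - 1) * k" ..
  then show "\<forall>a :: 'a. a \<noteq> 0 \<longrightarrow> a ^ n = 1"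
    by (metis power_card_minus_one power_mult power_one)
next
  assume *: "\<forall>a :: 'a. a \<noteq> 0 \<longrightarrow> a ^ n = 1"
  define r where "r = n mod (CARD('a) - 1)"
  have r_less: "r < CARD('a) - 1"
    using one_less_card_field[where 'a = 'a] by (simp add: r_def)
  have "a ^ r = 1" if "a \<noteq> 0" for a :: 'a
  proof -
    have "a ^ n = a ^ ((CARD('a) - 1) * (n div (CARD('a) - 1)) + r)"
      by (simp add: r_def)
    then show ?thesis
      using * that by (simp add: power_add power_mult power_card_minus_one del: One_nat_def)
  qed
  then have sub: "UNIV - {0} \<subseteq> {a :: 'a. poly (monom 1 r - 1) a = 0}"
    by (auto simp: poly_monom)
  show "(CARD('a) - 1) dvd n"
  proof (rule ccontr)
    assume "\<not> (CARD('a) - 1) dvd n"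
    then have "r > 0" by (simp add: r_def dvd_eq_mod_eq_0)
    then have "coeff (monom 1 r - 1 :: 'a poly) r \<noteq> 0"
      by simp
    then have "monom 1 r - 1 \<noteq> (0 :: 'a poly)"
      by (metis coeff_0)
    then have "card {a :: 'a. poly (monom 1 r - 1) a = 0} \<le> degree (monom 1 r - 1 :: 'a poly)"
      by (rule card_poly_roots_bound)
    also have "\<dots> \<le> r"
      by (rule degree_diff_le) (simp_all add: degree_monom_le)
    finally have "card (UNIV - {0 :: 'a}) \<le> r"
      using card_mono[OF _ sub] by (meson finite le_trans)
    with r_less show False by (simp add: card_Diff_singleton)
  qed
qed

section \<open>Substitution homomorphisms in two variables\<close>

lemma poly2_induct [case_names const add x y]:
  fixes f :: "'a::comm_ring_1 poly poly"
  assumes "\<And>c. P (const c)" "\<And>f g. P f \<Longrightarrow> P g \<Longrightarrow> P (f + g)"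
    and "\<And>f. P f \<Longrightarrow> P (var_x * f)" "\<And>f. P f \<Longrightarrow> P (var_y * f)"
  shows "P f"
proof (induction f)
  case 0
  then show ?case using assms(1)[of 0] by simp
next
  case (pCons p f)
  have "P [:p:]"
  proof (induction p)
    case 0
    then show ?case using assms(1)[of 0] by simp
  next
    case (pCons c p)
    have "P (const c + var_x * [:p:])"
      by (intro assms pCons)
    then show ?case by (simp add: const_def var_x_def)
  qed
  then have "P ([:p:] + var_y * f)"
    by (intro assms pCons)
  then show ?case by (simp add: var_y_def)
qed

lemma subst2_subst2:
  "subst2 u v (subst2 u' v' f) = subst2 (subst2 u v u') (subst2 u v v') f"
  by (induction f rule: poly2_induct) (simp_all add: subst2_add subst2_mult)

lemma subst2_id: "subst2 var_x var_y f = f"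
  by (induction f rule: poly2_induct) (simp_all add: subst2_add subst2_mult)

text \<open>When x is fixed, substitution is composition in the outer variable; this makes the
  degree formula and the injectivity of \<open>pcompose\<close> available.\<close>

lemma subst2_var_x_eq_pcompose: "subst2 var_x v f = pcompose f v"
  by (induction f rule: poly2_induct)
    (simp_all add: subst2_add subst2_mult pcompose_add pcompose_mult,
     simp_all add: const_def var_x_def var_y_def pcompose_pCons)

lemma subst2_sum: "subst2 u v (\<Sum>i\<in>I. f i) = (\<Sum>i\<in>I. subst2 u v (f i))"
  by (induction I rule: infinite_finite_induct) (simp_all add: subst2_add)

lemma var_x_power: "var_x ^ n = [:monom 1 n:]"
  by (induction n) (simp_all add: var_x_def one_pCons monom_Suc mult.commute)

lemma var_y_power: "var_y ^ n = monom 1 n"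
  by (induction n) (simp_all add: var_y_def monom_Suc)

lemma poly2_as_sum:
  "f = (\<Sum>j\<le>degree f. \<Sum>i\<le>degree (coeff f j).
     const (coeff (coeff f j) i) * var_x ^ i * var_y ^ j)"
proof -
  have 1: "[:p:] = (\<Sum>i\<le>degree p. const (coeff p i) * var_x ^ i)" for p :: "'a poly"
  proof -
    have "[:\<Sum>i\<in>I. g i:] = (\<Sum>i\<in>I. [:g i:])" for g :: "nat \<Rightarrow> 'a poly" and I
    proof (induction I rule: infinite_finite_induct)
      case (insert i I)
      have "[:g i + sum g I:] = [:g i:] + [:sum g I:]" by simp
      with insert show ?case by simp
    qed simp_all
    then have "[:p:] = (\<Sum>i\<le>degree p. [:monom (coeff p i) i:])"
      by (metis (no_types) poly_as_sum_of_monoms)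
    then show ?thesis
      by (simp add: const_def var_x_power smult_monom)
  qed
  have "f = (\<Sum>j\<le>degree f. [:coeff f j:] * var_y ^ j)"
    by (subst (1) poly_as_sum_of_monoms[of f, symmetric]) (simp add: var_y_power smult_monom)
  then show ?thesis
    by (subst (asm) 1) (simp add: sum_distrib_right)
qed

lemma power_in_range_subst2: "f \<in> range (subst2 u v) \<Longrightarrow> f ^ n \<in> range (subst2 u v)"
  by (metis (no_types, lifting) rangeE rangeI subst2_power)

lemma mult_in_range_subst2:
  "f \<in> range (subst2 u v) \<Longrightarrow> g \<in> range (subst2 u v) \<Longrightarrow> f * g \<in> range (subst2 u v)"
  by (metis (no_types, lifting) rangeE rangeI subst2_mult)

lemma sum_in_range_subst2:
  "(\<And>i. i \<in> I \<Longrightarrow> f i \<in> range (subst2 u v)) \<Longrightarrow> (\<Sum>i\<in>I. f i) \<in> range (subst2 u v)"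
proof (induction I rule: infinite_finite_induct)
  case (insert i I)
  then show ?case
    by simp (metis (no_types, lifting) rangeE rangeI subst2_add)
qed (auto intro: range_eqI[of _ _ 0])

lemma const_in_range_subst2: "const c \<in> range (subst2 u v)"
  by (rule range_eqI[of _ _ "const c"]) simp

text \<open>Over the domain F_q[x], the q elements c x are distinct roots in y. Identities of
  y-degree below q can therefore be tested on the lines y = c x.\<close>

lemma poly2_eq_0_if_many_roots:
  fixes f :: "'a::finite_field poly poly"
  assumes "\<And>c. poly f [:0, c:] = 0" "degree f < CARD('a)"
  shows "f = 0"
proof (rule ccontr)
  assume "f \<noteq> 0"
  then have fin: "finite {p. poly f p = 0}"
    by (rule poly_roots_finite)
  have "CARD('a) = card (range (\<lambda>c :: 'a. [:0, c:]))"
    by (rule card_image[symmetric]) (simp add: inj_def)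
  also have "\<dots> \<le> card {p. poly f p = 0}"
    using assms(1) fin by (intro card_mono) auto
  also have "\<dots> \<le> degree f"
    using \<open>f \<noteq> 0\<close> by (rule card_poly_roots_bound)
  finally show False using assms(2) by simp
qed

section \<open>The Borel group and its unipotent invariants\<close>

definition bmat :: "'a::field \<Rightarrow> 'a \<Rightarrow> 'a \<Rightarrow> 'a ^ 2 ^ 2"
  where "bmat a b d = vector [vector [a, b], vector [0, d]]"

lemma bmat_nth [simp]:
  "bmat a b d $ 1 $ 1 = a" "bmat a b d $ 1 $ 2 = b" "bmat a b d $ 2 $ 1 = 0" "bmat a b d $ 2 $ 2 = d"
  by (simp_all add: bmat_def)

lemma borel_group_iff:
  "g \<in> borel_group \<longleftrightarrow> g $ 1 $ 1 \<noteq> 0 \<and> g $ 2 $ 2 \<noteq> 0 \<and> g $ 2 $ 1 = 0"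
  by (auto simp: borel_group_def invertible_det_nz det_2)

lemma bmat_in_borel_group [simp]: "bmat a b d \<in> borel_group \<longleftrightarrow> a \<noteq> 0 \<and> d \<noteq> 0"
  by (simp add: borel_group_iff)

lemma borel_groupE:
  assumes "g \<in> borel_group"
  obtains a b d where "g = bmat a b d" "a \<noteq> 0" "d \<noteq> 0"
proof
  show "g = bmat (g $ 1 $ 1) (g $ 1 $ 2) (g $ 2 $ 2)"
    using assms by (auto simp: borel_group_iff vec_eq_iff forall_2)
qed (use assms in \<open>auto simp: borel_group_iff\<close>)

lemma bmat_mult: "bmat a b d ** bmat a' b' d' = bmat (a * a') (a * b' + b * d') (d * d')"
  by (simp add: vec_eq_iff forall_2 matrix_matrix_mult_def sum_2)

lemma sum_borel_group:
  fixes h :: "'a::{field, finite} ^ 2 ^ 2 \<Rightarrow> 'b::comm_monoid_add"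
  shows "(\<Sum>g\<in>borel_group. h g) = (\<Sum>a\<in>UNIV - {0}. \<Sum>b\<in>UNIV. \<Sum>d\<in>UNIV - {0}. h (bmat a b d))"
proof -
  have "(\<Sum>g\<in>borel_group. h g) = (\<Sum>(a, b, d)\<in>(UNIV - {0}) \<times> UNIV \<times> (UNIV - {0}). h (bmat a b d))"
    by (rule sum.reindex_bij_witness[of _ "\<lambda>(a, b, d). bmat a b d" "\<lambda>g. (g $ 1 $ 1, g $ 1 $ 2, g $ 2 $ 2)"])
      (auto elim!: borel_groupE)
  then show ?thesis
    by (simp add: sum.cartesian_product split_def)
qed

lemma act_simps [simp]:
  "act g 0 = 0" "act g 1 = 1" "act g (const c) = const c"
  "act g var_x = const (g $ 1 $ 1) * var_x"
  "act g var_y = const (g $ 1 $ 2) * var_x + const (g $ 2 $ 2) * var_y"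
  "act g (f1 + f2) = act g f1 + act g f2"
  "act g (f1 - f2) = act g f1 - act g f2"
  "act g (f1 * f2) = act g f1 * act g f2"
  "act g (f1 ^ n) = act g f1 ^ n"
  "act g (\<Sum>i\<in>I. f i) = (\<Sum>i\<in>I. act g (f i))"
  by (simp_all add: act_def subst2_add subst2_diff subst2_mult subst2_power subst2_sum)

lemma act_subst2: "act g (subst2 u v f) = subst2 (act g u) (act g v) f"
  by (simp add: act_def subst2_subst2)

lemma act_act:
  assumes "g \<in> borel_group" "h \<in> borel_group"
  shows "act g (act h f) = act (g ** h) f"
proof -
  from assms obtain a b d a' b' d' where "g = bmat a b d" "h = bmat a' b' d'"
    by (auto elim!: borel_groupE)
  then show ?thesis
    by (simp add: bmat_mult)
      (simp add: act_def subst2_subst2 subst2_add subst2_mult const_add const_mult algebra_simps)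
qed

text \<open>The inverse of an upper triangular matrix, written out so that its properties become
  computations with entries.\<close>

definition binv :: "'a::field ^ 2 ^ 2 \<Rightarrow> 'a ^ 2 ^ 2"
  where "binv g = bmat (1 / g $ 1 $ 1) (- g $ 1 $ 2 / (g $ 1 $ 1 * g $ 2 $ 2)) (1 / g $ 2 $ 2)"

lemma binv_in_borel_group: "g \<in> borel_group \<Longrightarrow> binv g \<in> borel_group"
  by (auto simp: binv_def borel_group_iff)

lemma binv_binv: "g \<in> borel_group \<Longrightarrow> binv (binv g) = g"
  by (auto elim!: borel_groupE simp: binv_def)

lemma act_binv:
  assumes "g \<in> borel_group"
  shows "act g (act (binv g) f) = f"
proof -
  from assms obtain a b d where *: "g = bmat a b d" "a \<noteq> 0" "d \<noteq> 0"
    by (rule borel_groupE)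
  then have "g ** binv g = bmat 1 0 1"
    by (simp add: binv_def bmat_mult)
  then have "act g (act (binv g) f) = act (bmat 1 0 1) f"
    using assms by (simp add: act_act binv_in_borel_group)
  then show ?thesis
    by (simp add: act_def subst2_id)
qed

text \<open>This is the product of the forms y - c x over all c in F_q, that is, the orbit product
  of y under the unipotent subgroup.\<close>

definition lin_poly :: "'a::finite_field poly poly"
  where "lin_poly = var_y ^ CARD('a) - var_x ^ (CARD('a) - 1) * var_y"

lemma coeff_linear_power_top:
  "coeff ([:u, v:] ^ n) n = v ^ n" for u v :: "'a::comm_ring_1"
proof (induction n)
  case (Suc n)
  have "degree ([:u, v:] ^ n) \<le> degree [:u, v:] * n"
    by (rule degree_power_le)
  also have "\<dots> \<le> n" by (cases "v = 0") auto
  finally have "coeff ([:u, v:] ^ n) (Suc n) = 0"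
    by (intro coeff_eq_0) simp
  with Suc show ?case by simp
qed simp

lemma degree_linear_power_le: "degree ([:u, v:] ^ n) \<le> n" for u v :: "'a::comm_ring_1"
  using degree_power_le[of "[:u, v:]" n] by (cases "v = 0") auto

lemma degree_less_if_coeff_eq_0: "degree f \<le> n \<Longrightarrow> coeff f n = 0 \<Longrightarrow> 0 < n \<Longrightarrow> degree f < n"
  by (metis coeff_0_degree_minus_1 diff_less le_neq_implies_less less_one
      le_less_trans degree_0 leading_coeff_0_iff)

lemma linear_form_eq: "const b * var_x + const d * var_y = [:[:0, b:], [:d:]:]"
  by (simp add: const_def var_x_def var_y_def)

lemma scaled_var_power_card:
  "[:0, c:] ^ CARD('a) = smult c ([:0, 1:] ^ CARD('a))" for c :: "'a::finite_field"
proof -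
  have "[:0, c:] ^ CARD('a) = smult c [:0, 1:] ^ CARD('a)" by simp
  also have "\<dots> = smult (c ^ CARD('a)) ([:0, 1:] ^ CARD('a))" by (rule smult_power)
  finally show ?thesis by (simp add: finite_field_power_card_eq_same)
qed

text \<open>Additivity of Frobenius, shown without binomial coefficients: both sides have the same
  coefficient at y^q because d^q = d, and they agree on the q lines y = c x. Their difference has
  y-degree below q and q roots.\<close>

lemma linear_form_power_card:
  fixes b d :: "'a::finite_field"
  defines "q \<equiv> CARD('a)"
  shows "(const b * var_x + const d * var_y) ^ q = const b * var_x ^ q + const d * var_y ^ q"
    (is "?l = ?r")
proof -
  have q: "0 < q" by (simp add: q_def)
  have x: "var_x ^ q = [:[:0, 1:] ^ q:]" and c: "[:d:] ^ q = [:d:]"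
    by (simp_all add: var_x_def q_def flip: poly_const_pow)
       (metis finite_field_power_card_eq_same poly_const_pow)
  have "degree (?l - ?r) \<le> q"
    unfolding linear_form_eq
    by (intro degree_diff_le degree_add_le degree_linear_power_le)
      (simp_all add: const_def x var_y_power degree_monom_le)
  moreover have "coeff (?l - ?r) q = 0"
    unfolding linear_form_eq
    using q by (simp add: coeff_linear_power_top c const_def x var_y_power coeff_pCons split: nat.splits)
  ultimately have "degree (?l - ?r) < q"
    using q by (rule degree_less_if_coeff_eq_0)
  moreover have "poly (?l - ?r) [:0, c:] = 0" for c
  proof -
    note e = scaled_var_power_card[where 'a = 'a, folded q_def]
    have "poly ?l [:0, c:] = [:0, b + d * c:] ^ q"
      by (simp add: const_def var_x_def var_y_def mult.commute)
    moreover have "poly ?r [:0, c:] = smult b ([:0, 1:] ^ q) + smult d ([:0, c:] ^ q)"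
      by (simp add: const_def var_x_def var_y_def)
    ultimately show ?thesis
      by (simp only: poly_diff e[of c] e[of "b + d * c"] smult_add_left smult_smult diff_self)
  qed
  ultimately have "?l - ?r = 0"
    unfolding q_def by (intro poly2_eq_0_if_many_roots)
  then show ?thesis by simp
qed

text \<open>The terms b x^q coming from y^q and from x^(q-1) y cancel, and a^(q-1) = 1 removes the
  first torus entry.\<close>

lemma act_lin_poly:
  assumes "g \<in> borel_group"
  shows "act g lin_poly = const (g $ 2 $ 2) * lin_poly"
proof -
  have "(const (g $ 1 $ 1)) ^ (CARD('a) - 1) = (1 :: 'a poly poly)"
    using assms by (simp add: borel_group_iff power_card_minus_one del: One_nat_def flip: const_power)
  moreover have "(var_x :: 'a poly poly) ^ CARD('a) = var_x * var_x ^ (CARD('a) - 1)"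
    by (simp flip: power_Suc)
  ultimately show ?thesis
    by (simp add: lin_poly_def linear_form_power_card power_mult_distrib) (simp add: algebra_simps)
qed

lemma lin_poly_monic: "degree (lin_poly :: 'a::finite_field poly poly) = CARD('a)"
    "coeff (lin_poly :: 'a poly poly) CARD('a) = 1"
proof -
  have 1: "lin_poly = monom 1 CARD('a) - [:0, [:0, 1 :: 'a:] ^ (CARD('a) - 1):]"
    by (simp add: lin_poly_def var_y_power) (simp add: var_x_def var_y_def poly_const_pow)
  show c: "coeff (lin_poly :: 'a poly poly) CARD('a) = 1"
    using one_less_card_field[where 'a = 'a] unfolding 1
    by (simp add: coeff_pCons split: nat.splits)
  have "degree (lin_poly :: 'a poly poly) \<le> CARD('a)"
    unfolding 1 by (intro degree_diff_le degree_monom_le) (simp add: Suc_leI)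
  moreover have "CARD('a) \<le> degree (lin_poly :: 'a poly poly)"
    by (rule le_degree) (simp add: c)
  ultimately show "degree (lin_poly :: 'a poly poly) = CARD('a)" by simp
qed

lemma poly_lin_poly: "poly lin_poly [:0, c:] = 0" for c :: "'a::finite_field"
proof -
  have "[:0, 1 :: 'a:] ^ CARD('a) = [:0, 1:] * [:0, 1:] ^ (CARD('a) - 1)"
    by (simp flip: power_Suc)
  then have "[:0, c:] ^ CARD('a) = [:0, c:] * [:0, 1:] ^ (CARD('a) - 1)"
    by (simp add: scaled_var_power_card[of c])
  then show ?thesis
    by (simp add: lin_poly_def var_y_def) (simp add: var_x_def poly_const_pow)
qed

text \<open>The remainder on division by \<open>lin_poly\<close> has y-degree below q and still
  vanishes on all lines y = c x, so it is zero.\<close>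

lemma lin_poly_dvd:
  fixes f :: "'a::finite_field poly poly"
  assumes "\<And>c. poly f [:0, c:] = 0"
  shows "lin_poly dvd f"
proof -
  have nz: "(lin_poly :: 'a poly poly) \<noteq> 0"
    using lin_poly_monic(1)[where 'a = 'a] by force
  obtain h r where hr: "pseudo_divmod f lin_poly = (h, r)" by force
  \<comment> \<open>The leading coefficient of \<open>lin_poly\<close> is 1, so pseudo-division is
    division with remainder although the coefficient ring F_q[x] is not a field.\<close>
  have f: "f = lin_poly * h + r"
    using pseudo_divmod(1)[OF nz hr] by (simp add: lin_poly_monic)
  then have "poly r [:0, c:] = 0" for c
    using assms[of c] by (simp add: poly_lin_poly)
  moreover have "degree r < CARD('a)"
    using pseudo_divmod(2)[OF nz hr] by (auto simp: lin_poly_monic)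
  ultimately have "r = 0" by (rule poly2_eq_0_if_many_roots)
  with f show ?thesis by simp
qed

text \<open>Induction on the y-degree: f - f(x, 0) vanishes on all lines y = c x, hence is
  \<open>lin_poly\<close> times a quotient, and the quotient is again invariant because
  \<open>lin_poly\<close> is.\<close>

lemma unipotent_invariant_imp_pcompose:
  fixes f :: "'a::finite_field poly poly"
  assumes "\<And>b. act (bmat 1 b 1) f = f"
  shows "\<exists>F. f = pcompose F lin_poly"
  using assms
proof (induction "degree f" arbitrary: f rule: less_induct)
  case less
  have "poly f [:0, b:] = poly f 0" for b
  proof -
    \<comment> \<open>Evaluating the invariance under y -> b x + y at y = 0 carries the value at 0
      to the value at b x.\<close>
    have "poly f 0 = poly (act (bmat 1 b 1) f) 0" by (simp add: less.prems)
    also have "act (bmat 1 b 1) f = pcompose f (const b * var_x + const 1 * var_y)"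
      by (simp add: act_def flip: subst2_var_x_eq_pcompose)
    finally show ?thesis
      unfolding linear_form_eq poly_pcompose by simp
  qed
  then have "lin_poly dvd f - [:poly f 0:]"
    by (intro lin_poly_dvd) simp
  then obtain h where h: "f - [:poly f 0:] = lin_poly * h" ..
  show ?case
  proof (cases "h = 0")
    case True
    with h have "f = pcompose [:poly f 0:] lin_poly"
      by (metis pcompose_const mult_zero_right eq_iff_diff_eq_0)
    then show ?thesis ..
  next
    case False
    have nz: "(lin_poly :: 'a poly poly) \<noteq> 0"
      using lin_poly_monic(1)[where 'a = 'a] by force
    have q: "0 < CARD('a)" by simp
    have deg: "degree (f - [:poly f 0:]) = CARD('a) + degree h"
      by (simp add: h degree_mult_eq nz False lin_poly_monic)
    have "degree (f - [:poly f 0:]) \<le> degree f"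
      by (rule degree_diff_le) auto
    with deg q have "degree h < degree f" by linarith
    moreover have "act (bmat 1 b 1) h = h" for b
    proof -
      \<comment> \<open>A polynomial in x alone is fixed: in this form \<open>act_subst2\<close>
        applies, and the unipotent element fixes both x and 0.\<close>
      have c: "[:p:] = subst2 var_x 0 [:p:]" for p :: "'a poly"
        by (simp add: subst2_var_x_eq_pcompose)
      have "act (bmat 1 b 1) [:poly f 0:] = [:poly f 0:]"
        by (subst (1 2) c) (simp add: act_subst2)
      then have "act (bmat 1 b 1) (f - [:poly f 0:]) = f - [:poly f 0:]"
        by (simp add: less.prems)
      then have "lin_poly * act (bmat 1 b 1) h = lin_poly * h"
        unfolding h by (simp add: act_lin_poly)
      with nz show ?thesis by simp
    qed
    ultimately obtain F where F: "h = pcompose F lin_poly"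
      using less.hyps by blast
    \<comment> \<open>A Horner step: f = f(x, 0) + \<open>lin_poly\<close> h, with h already a
      composite.\<close>
    have "f = pcompose (pCons (poly f 0) F) lin_poly"
      using h by (simp add: F pcompose_pCons algebra_simps)
    then show ?thesis ..
  qed
qed

section \<open>The invariant ring\<close>

lemma coeff2_simps:
  "coeff (coeff (const c) j) i = (if i = 0 \<and> j = 0 then c else 0)"
  "coeff (coeff (const c * f) j) i = c * coeff (coeff f j) i"
  "coeff (coeff (var_x * f) j) i = (if i = 0 then 0 else coeff (coeff f j) (i - 1))"
  "coeff (coeff (var_y * f) j) i = (if j = 0 then 0 else coeff (coeff f (j - 1)) i)"
  by (simp_all add: const_def var_x_def var_y_def coeff_pCons split: nat.splits)

lemma coeff2_torus_act:
  "coeff (coeff (act (bmat a 0 d) f) j) i = a ^ i * d ^ j * coeff (coeff f j) i"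
proof (induction f arbitrary: i j rule: poly2_induct)
  case (x f)
  have "act (bmat a 0 d) (var_x * f) = const a * (var_x * act (bmat a 0 d) f)"
    by (simp add: mult.assoc)
  with x show ?case
    by (cases i) (simp_all only: coeff2_simps, simp_all)
next
  case (y f)
  have "act (bmat a 0 d) (var_y * f) = const d * (var_y * act (bmat a 0 d) f)"
    by (simp add: mult.assoc)
  with y show ?case
    by (cases j) (simp_all only: coeff2_simps, simp_all)
qed (simp_all add: coeff2_simps algebra_simps)

text \<open>The torus scales \<open>lin_poly\<close> by d just as it scales y, so acting on the
  composite amounts to acting on F. Composition with \<open>lin_poly\<close> is injective, hence F
  is itself torus invariant and only monomials of trivial weight occur in it.\<close>

lemma invariants_imp_pcompose:
  fixes f :: "'a::finite_field poly poly"
  assumes "f \<in> invariants"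
  obtains F where "f = pcompose F lin_poly"
    "\<And>i j. coeff (coeff F j) i \<noteq> 0 \<Longrightarrow> (CARD('a) - 1) dvd i \<and> (CARD('a) - 1) dvd j"
proof -
  have act: "act g f = f" if "g \<in> borel_group" for g
    using assms that by (auto simp: invariants_def)
  obtain F where F: "f = pcompose F lin_poly"
    using unipotent_invariant_imp_pcompose[of f] act by auto
  have torus: "act (bmat a 0 d) F = F" if "a \<noteq> 0" "d \<noteq> 0" for a d
  proof -
    have "subst2 var_x lin_poly (act (bmat a 0 d) F) = act (bmat a 0 d) (subst2 var_x lin_poly F)"
      using that unfolding act_subst2
      by (simp add: act_lin_poly) (simp add: act_def subst2_subst2 subst2_mult)
    also have "\<dots> = subst2 var_x lin_poly F"
      using that act[of "bmat a 0 d"] by (simp add: F subst2_var_x_eq_pcompose)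
    finally have "pcompose (act (bmat a 0 d) F - F) lin_poly = 0"
      by (simp add: subst2_var_x_eq_pcompose pcompose_diff)
    then have "act (bmat a 0 d) F - F = 0"
      by (rule pcompose_eq_0) (simp add: lin_poly_monic)
    then show ?thesis by simp
  qed
  have *: "a ^ i * d ^ j = 1" if "coeff (coeff F j) i \<noteq> 0" "a \<noteq> 0" "d \<noteq> 0" for a d :: 'a and i j
    using coeff2_torus_act[of a d F j i] that by (simp add: torus)
  \<comment> \<open>Setting d = 1 and then a = 1 in the weight condition separates the two
    exponents.\<close>
  have "(CARD('a) - 1) dvd i \<and> (CARD('a) - 1) dvd j" if "coeff (coeff F j) i \<noteq> 0" for i j
    unfolding power_eq_one_iff_card_minus_one_dvd[symmetric]
    using *[OF that, of _ 1] *[OF that, of 1] by simp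
  with F show ?thesis by (rule that)
qed

section \<open>X and D generate the invariant ring\<close>

lemma poly_D_eq: "poly_D = poly_Y * (\<Sum>i<CARD('a). poly_X ^ i * poly_Y ^ (CARD('a) - 1 - i))
    + (poly_X :: 'a::finite_field poly poly) ^ CARD('a)"
proof -
  have "poly_D = (\<Sum>i<CARD('a). poly_X ^ i * poly_Y ^ (CARD('a) - i))
      + (poly_X :: 'a poly poly) ^ CARD('a)"
    unfolding poly_D_def lessThan_Suc_atMost[symmetric] by simp
  also have "(\<Sum>i<CARD('a). poly_X ^ i * poly_Y ^ (CARD('a) - i)) =
      (\<Sum>i<CARD('a). poly_Y * (poly_X ^ i * (poly_Y :: 'a poly poly) ^ (CARD('a) - 1 - i)))"
  proof (rule sum.cong)
    fix i assume "i \<in> {..<CARD('a)}"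
    then have "CARD('a) - i = Suc (CARD('a) - 1 - i)" by auto
    then show "poly_X ^ i * poly_Y ^ (CARD('a) - i) =
      poly_Y * (poly_X ^ i * (poly_Y :: 'a poly poly) ^ (CARD('a) - 1 - i))"
      by (simp only: power_Suc mult_ac)
  qed simp
  finally show ?thesis by (simp add: sum_distrib_left)
qed

text \<open>The geometric sum s satisfies (Y - X) s = Y^q - X^q = (Y - X)^q, so s = (Y - X)^(q-1).
  Since \<open>lin_poly\<close> = y (Y - X), its (q-1)-st power is Y s, which is D without its last
  term X^q.\<close>

lemma poly_D_eq_lin_poly:
  "poly_D = lin_poly ^ (CARD('a) - 1) + (poly_X :: 'a::finite_field poly poly) ^ CARD('a)"
proof -
  define q where "q = CARD('a)"
  define X Y :: "'a poly poly" where "X = poly_X" and "Y = poly_Y"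
  define s where "s = (\<Sum>i<q. X ^ i * Y ^ (q - 1 - i))"
  have q: "q = Suc (q - 1)" "0 < q" by (simp_all add: q_def)
  have "(Y - X) * s = Y ^ q - X ^ q"
  proof -
    have "s = (\<Sum>i<q. Y ^ (q - Suc i) * X ^ i)"
      by (simp add: s_def mult.commute)
    then have "X ^ q - Y ^ q = (X - Y) * s"
      by (simp only: power_diff_sumr2[of X q Y])
    then show ?thesis by (simp add: algebra_simps)
  qed
  \<comment> \<open>Additivity of the q-th power for the form y - x, transported by x -> X and y ->
    Y.\<close>
  also have "\<dots> = (Y - X) ^ q"
    using arg_cong[OF linear_form_power_card[of "- 1 :: 'a" 1], of "subst2 X Y"]
    by (simp add: q_def subst2_add subst2_diff subst2_mult subst2_power)
  also have "\<dots> = (Y - X) * (Y - X) ^ (q - 1)"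
    using q(1) by (metis power_Suc)
  finally have "(Y - X) * s = (Y - X) * (Y - X) ^ (q - 1)" .
  moreover have "Y - X \<noteq> 0"
  proof
    assume "Y - X = 0"
    then have "coeff (coeff (Y - X) (q - 1)) 0 = 0" by simp
    then show False
      using one_less_card_field[where 'a = 'a]
      by (simp add: X_def Y_def poly_X_def poly_Y_def q_def var_x_power var_y_power coeff_pCons split: nat.splits)
  qed
  ultimately have "s = (Y - X) ^ (q - 1)" by simp
  moreover have "lin_poly = var_y * (Y - X)"
    using q by (simp add: lin_poly_def Y_def X_def poly_Y_def poly_X_def algebra_simps flip: q_def power_Suc)
  then have "lin_poly ^ (q - 1) = (var_y * (Y - X)) ^ (q - 1)"
    by (rule arg_cong)
  then have "lin_poly ^ (q - 1) = Y * (Y - X) ^ (q - 1)"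
    by (simp only: power_mult_distrib) (simp only: Y_def poly_Y_def q_def)
  ultimately show ?thesis
    unfolding poly_D_eq by (simp add: s_def X_def Y_def q_def)
qed

lemma poly_D_invariant: "poly_D \<in> invariants"
proof -
  have "act g lin_poly ^ (CARD('a) - 1) = lin_poly ^ (CARD('a) - 1)"
    if "g \<in> borel_group" for g :: "'a ^ 2 ^ 2"
    using that
    by (simp add: act_lin_poly power_mult_distrib borel_group_iff power_card_minus_one
        del: One_nat_def flip: const_power)
  with poly_X_invariant[where 'a = 'a] show ?thesis
    by (simp add: invariants_def poly_D_eq_lin_poly)
qed

text \<open>The inner variable stands for D and the outer one for X, so that reduction modulo X
  keeps exactly the constant coefficient of the outer polynomial. For the inclusion of the
  invariants, the exponents in F are multiples of q - 1, which leaves products of powers of X and of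
  \<open>lin_poly ^ (CARD('a) - 1)\<close>.\<close>

lemma range_subst2_poly_D_poly_X: "range (subst2 poly_D poly_X) = invariants"
proof
  show "range (subst2 poly_D poly_X) \<subseteq> (invariants :: 'a poly poly set)"
    using poly_X_invariant[where 'a = 'a] poly_D_invariant[where 'a = 'a]
    by (auto simp: invariants_def act_subst2)
  show "invariants \<subseteq> range (subst2 poly_D (poly_X :: 'a poly poly))" (is "_ \<subseteq> ?R")
  proof
    fix f :: "'a poly poly"
    assume "f \<in> invariants"
    then obtain F where F: "f = pcompose F lin_poly"
      "\<And>i j. coeff (coeff F j) i \<noteq> 0 \<Longrightarrow> (CARD('a) - 1) dvd i \<and> (CARD('a) - 1) dvd j"
      by (rule invariants_imp_pcompose) blast
    have X: "poly_X \<in> ?R" by (rule range_eqI[of _ _ var_y]) simp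
    \<comment> \<open>The preimage below is D - X^q, read through
      \<open>poly_D_eq_lin_poly\<close>.\<close>
    have P: "lin_poly ^ (CARD('a) - 1) \<in> ?R"
      by (rule range_eqI[of _ _ "var_x - var_y ^ CARD('a)"])
        (simp add: subst2_diff subst2_power poly_D_eq_lin_poly)
    have "const (coeff (coeff F j) i) * var_x ^ i * lin_poly ^ j \<in> ?R" for i j
    proof (cases "coeff (coeff F j) i = 0")
      case True
      then show ?thesis using const_in_range_subst2[of 0] by simp
    next
      case False
      from F(2)[OF False] obtain k l where "i = (CARD('a) - 1) * k" "j = (CARD('a) - 1) * l"
        by (auto elim!: dvdE)
      then have "var_x ^ i = (poly_X :: 'a poly poly) ^ k"
        "lin_poly ^ j = (lin_poly ^ (CARD('a) - 1) :: 'a poly poly) ^ l"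
        by (simp_all add: poly_X_def power_mult)
      then show ?thesis
        using X P by (intro mult_in_range_subst2 const_in_range_subst2) (metis power_in_range_subst2)+
    qed
    moreover have "f = (\<Sum>j\<le>degree F. \<Sum>i\<le>degree (coeff F j).
        const (coeff (coeff F j) i) * var_x ^ i * lin_poly ^ j)"
      using arg_cong[OF poly2_as_sum[of F], of "subst2 var_x lin_poly"]
      by (simp add: F(1) subst2_sum subst2_mult subst2_power flip: subst2_var_x_eq_pcompose)
    ultimately show "f \<in> ?R"
      by (metis (no_types, lifting) sum_in_range_subst2)
  qed
qed

text \<open>The y-degree of f is q times that of F, and the y-degree of F is a multiple of q - 1;
  below q (q - 1) it must be 0. This determines transfers of small y-degree from their values at y =
  0.\<close>

lemma invariants_degree_less:
  fixes f :: "'a::finite_field poly poly"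
  assumes "f \<in> invariants" "degree f < CARD('a) * (CARD('a) - 1)"
  shows "f = [:poly f 0:]"
proof -
  obtain F where F: "f = pcompose F lin_poly"
    "\<And>i j. coeff (coeff F j) i \<noteq> 0 \<Longrightarrow> (CARD('a) - 1) dvd i \<and> (CARD('a) - 1) dvd j"
    using invariants_imp_pcompose[OF assms(1)] by blast
  have "degree F < CARD('a) - 1"
    using assms(2) by (simp add: F(1) degree_pcompose lin_poly_monic mult.commute[of _ "CARD('a)"])
  moreover have "(CARD('a) - 1) dvd degree F"
  proof (cases "F = 0")
    case False
    then have "coeff F (degree F) \<noteq> 0" by simp
    then obtain i where "coeff (coeff F (degree F)) i \<noteq> 0"
      by (metis leading_coeff_0_iff)
    then show ?thesis using F(2) by blast
  qed simp
  ultimately have "degree F = 0"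
    by (auto dest: dvd_imp_le)
  then obtain p where "F = [:p:]"
    by (rule degree_eq_zeroE)
  then have "f = [:p:]" by (simp add: F(1))
  then show ?thesis by simp
qed

text \<open>Restriction to the line x = 0. The ideal (x) is stable under the Borel group, which acts
  on the quotient by the scalings y -> d y.\<close>

definition at_x0 :: "'a::comm_ring_1 poly poly \<Rightarrow> 'a poly"
  where "at_x0 f = map_poly (\<lambda>p. coeff p 0) f"

lemma coeff_at_x0 [simp]: "coeff (at_x0 f) k = coeff (coeff f k) 0"
  by (simp add: at_x0_def coeff_map_poly)

lemma at_x0_simps [simp]:
  "at_x0 0 = 0"
  "at_x0 (const c) = [:c:]" "at_x0 var_x = 0" "at_x0 var_y = [:0, 1:]"
  "at_x0 (f + g) = at_x0 f + at_x0 g"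
  "at_x0 (f - g) = at_x0 f - at_x0 g"
  "at_x0 (f * g) = at_x0 f * at_x0 g"
  by (rule poly_eqI; simp add: const_def var_x_def var_y_def coeff_pCons coeff_mult coeff_sum
        coeff_mult_0 split: nat.split)+

lemma at_x0_1 [simp]: "at_x0 1 = 1"
  using at_x0_simps(2)[of 1] by (simp add: one_pCons)

lemma at_x0_power [simp]: "at_x0 (f ^ n) = at_x0 f ^ n"
  by (induction n) simp_all

lemma at_x0_sum [simp]: "at_x0 (\<Sum>i\<in>I. f i) = (\<Sum>i\<in>I. at_x0 (f i))"
  by (induction I rule: infinite_finite_induct) simp_all

lemma at_x0_poly_X [simp]: "at_x0 (poly_X :: 'a::finite_field poly poly) = 0"
  using one_less_card_field[where 'a = 'a] by (simp add: poly_X_def)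

lemma at_x0_poly_Y [simp]: "at_x0 (poly_Y :: 'a::finite_field poly poly) = monom 1 (CARD('a) - 1)"
  by (simp add: poly_Y_def) (simp add: monom_altdef)

lemma at_x0_poly_D [simp]:
  "at_x0 (poly_D :: 'a::finite_field poly poly) = monom 1 (CARD('a) * (CARD('a) - 1))"
proof -
  have "at_x0 (lin_poly :: 'a poly poly) = monom 1 CARD('a)"
    using one_less_card_field[where 'a = 'a] by (simp add: lin_poly_def monom_altdef)
  then show ?thesis
    by (simp add: poly_D_eq_lin_poly monom_power)
qed

text \<open>Restriction sends X to 0 and D to y^(q(q-1)), so only the part free of X
  survives.\<close>

lemma at_x0_subst2:
  "at_x0 (subst2 poly_D poly_X G) = pcompose (coeff G 0) (monom 1 (CARD('a) * (CARD('a) - 1)))"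
    for G :: "'a::finite_field poly poly"
proof (induction G rule: poly2_induct)
  case (const c)
  then show ?case by (simp add: const_def[of c, THEN arg_cong[of _ _ "\<lambda>p. coeff p 0"]])
next
  case (x f)
  then show ?case
    by (simp add: subst2_mult var_x_def[THEN arg_cong[of _ _ "\<lambda>p. coeff (p * f) 0"]] pcompose_pCons)
next
  case (y f)
  then show ?case
    by (simp add: subst2_mult var_y_def[THEN arg_cong[of _ _ "\<lambda>p. coeff (p * f) 0"]])
qed (simp add: subst2_add pcompose_add)

lemma at_x0_subst2_eq_0_iff:
  "at_x0 (subst2 poly_D poly_X G) = 0 \<longleftrightarrow> coeff G 0 = 0" for G :: "'a::finite_field poly poly"
  unfolding at_x0_subst2 using one_less_card_field[where 'a = 'a]
  by (intro pcompose_eq_0_iff) (simp add: degree_monom_eq)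

lemma subst2_poly_D_poly_X_pCons_0:
  "subst2 poly_D poly_X (pCons 0 G) = poly_X * subst2 poly_D poly_X G"
proof -
  have "pCons 0 G = var_y * G" by (simp add: var_y_def)
  then show ?thesis by (simp add: subst2_mult)
qed

lemma poly_X_neq_0: "(poly_X :: 'a::finite_field poly poly) \<noteq> 0"
  by (simp add: poly_X_def var_x_def)

text \<open>Algebraic independence of D and X: restriction to x = 0 kills the part free of X, after
  which a factor X cancels and the induction applies.\<close>

lemma subst2_poly_D_poly_X_eq_0:
  fixes G :: "'a::finite_field poly poly"
  shows "subst2 poly_D poly_X G = 0 \<Longrightarrow> G = 0"
proof (induction G)
  case (pCons p G)
  from pCons.prems have "at_x0 (subst2 poly_D poly_X (pCons p G)) = 0" by simp
  then have "p = 0" unfolding at_x0_subst2_eq_0_iff by simp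
  with pCons show ?case
    by (simp add: subst2_poly_D_poly_X_pCons_0 poly_X_neq_0)
qed simp

lemma inj_subst2_poly_D_poly_X: "inj (subst2 poly_D (poly_X :: 'a::finite_field poly poly))"
proof (rule injI)
  fix F G :: "'a poly poly"
  assume "subst2 poly_D poly_X F = subst2 poly_D poly_X G"
  then have "subst2 poly_D poly_X (F - G) = 0" by (simp add: subst2_diff)
  then show "F = G" using subst2_poly_D_poly_X_eq_0[of "F - G"] by simp
qed

text \<open>On S^B the kernel of the restriction to x = 0 is the ideal (X), with an invariant
  cofactor. Both the image of the transfer and the coefficients of the torsion relations are handled
  through this.\<close>

lemma poly_X_dvd_invariant:
  assumes "f \<in> invariants" "at_x0 f = 0"
  obtains r where "r \<in> invariants" "f = poly_X * r"
proof -
  from assms(1) obtain G where G: "f = subst2 poly_D poly_X G"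
    by (auto simp flip: range_subst2_poly_D_poly_X)
  obtain p H where H: "G = pCons p H" by (rule pCons_cases)
  have "p = 0" using assms(2) by (simp add: G H at_x0_subst2_eq_0_iff)
  then have "f = poly_X * subst2 poly_D poly_X H"
    by (simp add: G H subst2_poly_D_poly_X_pCons_0)
  then show ?thesis
    by (intro that[of "subst2 poly_D poly_X H"]) (auto simp flip: range_subst2_poly_D_poly_X)
qed

section \<open>The transfer map\<close>

definition borel_trace :: "'a::finite_field poly poly \<Rightarrow> 'a poly poly"
  where "borel_trace f = (\<Sum>g\<in>borel_group. act g f)"

lemma trace_simps [simp]:
  "borel_trace 0 = 0" "borel_trace (f + h) = borel_trace f + borel_trace h" "borel_trace (f - h) = borel_trace f - borel_trace h"
  "borel_trace (const c * f) = const c * borel_trace f"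
  by (simp_all add: borel_trace_def sum.distrib sum_subtractf sum_distrib_left)

lemma trace_invariant_mult: "r \<in> invariants \<Longrightarrow> borel_trace (r * f) = r * borel_trace f"
  by (simp add: borel_trace_def invariants_def sum_distrib_left)

lemma borel_group_mult: "g \<in> borel_group \<Longrightarrow> h \<in> borel_group \<Longrightarrow> g ** h \<in> borel_group"
  by (simp add: borel_group_iff matrix_matrix_mult_def sum_2)

lemma bij_betw_borel_group_mult:
  fixes h :: "'a::finite_field ^ 2 ^ 2"
  assumes "h \<in> borel_group"
  shows "bij_betw (\<lambda>g. g ** h) borel_group borel_group" "bij_betw (\<lambda>g. h ** g) borel_group borel_group"
proof -
  obtain h' where h': "h ** h' = mat 1" "h' ** h = mat 1"
    using assms by (auto simp: borel_group_def invertible_def)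
  have "g = g'" if "g ** h = g' ** h" for g g' :: "'a ^ 2 ^ 2"
    by (metis that h'(1) matrix_mul_assoc matrix_mul_rid)
  moreover have "g = g'" if "h ** g = h ** g'" for g g' :: "'a ^ 2 ^ 2"
    by (metis that h'(2) matrix_mul_assoc matrix_mul_lid)
  ultimately have "inj_on (\<lambda>g. g ** h) borel_group" "inj_on (\<lambda>g. h ** g) borel_group"
    unfolding inj_on_def by blast+
  moreover from this have "(\<lambda>g. g ** h) ` borel_group = borel_group" "(\<lambda>g. h ** g) ` borel_group = borel_group"
    using assms by (simp_all add: endo_inj_surj image_subset_iff borel_group_mult)
  ultimately show "bij_betw (\<lambda>g. g ** h) borel_group borel_group" "bij_betw (\<lambda>g. h ** g) borel_group borel_group"
    by (simp_all only: bij_betw_def simp_thms)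
qed

lemma trace_act: "h \<in> borel_group \<Longrightarrow> borel_trace (act h f) = borel_trace f"
  using sum.reindex_bij_betw[OF bij_betw_borel_group_mult(1), of h "\<lambda>g. act g f"]
  by (simp add: borel_trace_def act_act)

lemma trace_in_invariants: "borel_trace f \<in> invariants"
proof -
  have "act h (borel_trace f) = borel_trace f" if "h \<in> borel_group" for h
    using sum.reindex_bij_betw[OF bij_betw_borel_group_mult(2), of h "\<lambda>g. act g f"] that
    by (simp add: borel_trace_def act_act)
  then show ?thesis by (simp add: invariants_def)
qed

lemma trace_cofixed_relations: "f \<in> cofixed_relations \<Longrightarrow> borel_trace f = 0"
  unfolding cofixed_relations_def
  by (induction rule: S.span_induct_alt) (auto simp: trace_act)

lemma at_x0_act: "at_x0 (act (bmat a b d) f) = pcompose (at_x0 f) [:0, d:]"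
  by (induction f rule: poly2_induct) (simp_all add: pcompose_add pcompose_mult pcompose_pCons)

text \<open>On the line x = 0 the action does not depend on b, so the sum over b contributes the
  factor q = 0.\<close>

lemma at_x0_trace: "at_x0 (borel_trace f) = 0" for f :: "'a::finite_field poly poly"
  by (simp add: borel_trace_def sum_borel_group at_x0_act of_nat_poly of_nat_card_field)

lemma sum_units_const:
  "(\<Sum>a\<in>UNIV - {0 :: 'a::finite_field}. c) = (- c :: 'b::comm_ring_1)"
  if "of_nat CARD('a) = (0 :: 'b)" for c
proof -
  have "(\<Sum>a\<in>(UNIV :: 'a set). c) = c + (\<Sum>a\<in>UNIV - {0 :: 'a}. c)"
    using sum.remove[of UNIV "0 :: 'a" "\<lambda>_. c"] by simp
  with that show ?thesis by (simp add: eq_neg_iff_add_eq_0 add.commute)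
qed

text \<open>Every unit contributes 1, and b = 0 contributes 0 because the exponent is positive; the
  total is q - 1 = -1.\<close>

lemma sum_all_power:
  fixes j :: nat
  assumes "0 < j"
  shows "(\<Sum>b\<in>(UNIV :: 'a::finite_field set). b ^ ((CARD('a) - 1) * j)) = - 1"
proof -
  have n: "(CARD('a) - 1) * j \<noteq> 0"
    using assms one_less_card_field[where 'a = 'a] by simp
  have "(\<Sum>b\<in>(UNIV :: 'a set). b ^ ((CARD('a) - 1) * j)) =
      0 ^ ((CARD('a) - 1) * j) + (\<Sum>b\<in>UNIV - {0 :: 'a}. b ^ ((CARD('a) - 1) * j))"
    by (rule sum.remove) auto
  also have "(\<Sum>b\<in>UNIV - {0 :: 'a}. b ^ ((CARD('a) - 1) * j)) = (\<Sum>b\<in>UNIV - {0 :: 'a}. 1)"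
    by (rule sum.cong) (auto simp: power_mult power_card_minus_one simp del: One_nat_def)
  finally show ?thesis
    using n by (simp add: sum_units_const of_nat_card_field power_0_left del: sum_constant)
qed

text \<open>For j < q the transfer has y-degree below q (q - 1), so it is a polynomial in x and can
  be computed at y = 0, where (b x + d y)^n becomes b^n x^n.\<close>

lemma trace_poly_Y_power:
  assumes "0 < j" "j < CARD('a)"
  shows "borel_trace (poly_Y ^ j) = - (poly_X ^ j :: 'a::finite_field poly poly)"
proof -
  define n where "n = (CARD('a) - 1) * j"
  have Yj: "poly_Y ^ j = (var_y ^ n :: 'a poly poly)" and Xj: "poly_X ^ j = (var_x ^ n :: 'a poly poly)"
    by (simp_all add: poly_X_def poly_Y_def n_def power_mult)
  have "degree (borel_trace (var_y ^ n :: 'a poly poly)) \<le> n"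
    unfolding borel_trace_def
    by (intro degree_sum_le) (simp_all add: linear_form_eq degree_linear_power_le)
  also have "n < CARD('a) * (CARD('a) - 1)"
    using assms one_less_card_field[where 'a = 'a] by (simp add: n_def)
  finally have 1: "borel_trace (var_y ^ n :: 'a poly poly) = [:poly (borel_trace (var_y ^ n)) 0:]"
    by (intro invariants_degree_less trace_in_invariants)
  have "poly (borel_trace (var_y ^ n :: 'a poly poly)) 0 =
      (\<Sum>a\<in>UNIV - {0 :: 'a}. \<Sum>b\<in>UNIV. \<Sum>d\<in>UNIV - {0 :: 'a}. monom (b ^ n) n)"
  proof -
    have "[:0, b:] ^ n = monom (b ^ n) n" for b :: 'a
      by (simp add: monom_power flip: monom_Suc[of b 0, simplified monom_0])
    then show ?thesis
      by (simp add: borel_trace_def sum_borel_group poly_sum linear_form_eq)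
  qed
  \<comment> \<open>The sums over the units a and d contribute -1 each, and these signs cancel; the
    remaining sign comes from the sum over b.\<close>
  also have "\<dots> = (\<Sum>b\<in>(UNIV :: 'a set). monom (b ^ n) n)"
    by (simp add: sum_units_const of_nat_poly of_nat_card_field sum_negf del: sum_constant)
  also have "\<dots> = monom (\<Sum>b\<in>(UNIV :: 'a set). b ^ n) n"
    by (simp add: poly_eq_iff coeff_sum)
  also have "\<dots> = - monom 1 n"
    unfolding n_def sum_all_power[OF assms(1)] by (simp add: minus_monom)
  finally show ?thesis
    using 1 by (simp add: Yj Xj var_x_power)
qed

lemma trace_1: "borel_trace 1 = (0 :: 'a::finite_field poly poly)"
  unfolding borel_trace_def sum_borel_group by (simp add: of_nat_poly of_nat_card_field)

lemma trace_poly_Y: "borel_trace poly_Y = - (poly_X :: 'a::finite_field poly poly)"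
  using trace_poly_Y_power[of 1, where 'a = 'a] one_less_card_field[where 'a = 'a] by simp

text \<open>The correction X^(j-1) Y has the same transfer -X^j as Y^j. For j = 0 the transfer of 1
  is the group order, which is 0 in F_q.\<close>

lemma trace_torsion_gen:
  assumes "j \<in> insert 0 {2..CARD('a) - 1}"
  shows "borel_trace (torsion_gen j) = (0 :: 'a::finite_field poly poly)"
proof (cases "j = 0")
  case False
  with assms have j: "2 \<le> j" "j < CARD('a)" by auto
  have "poly_X ^ (j - 1) \<in> (invariants :: 'a poly poly set)"
    using poly_X_invariant[where 'a = 'a] by (simp add: invariants_def)
  moreover have "(poly_X :: 'a poly poly) ^ j = poly_X ^ (j - 1) * poly_X"
    using j by (simp flip: power_Suc2)
  ultimately show ?thesis
    using j by (simp add: torsion_gen_def trace_poly_Y_power trace_invariant_mult trace_poly_Y)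
qed (simp add: torsion_gen_def trace_1)

text \<open>The image of the transfer annihilates Tate cohomology: multiplication by the transfer of
  \<open>Y\<close>, which is \<open>-X\<close>, factors through the transfer.\<close>

lemma poly_X_mult_cofixed:
  "poly_X * f + borel_trace f * poly_Y \<in> cofixed_relations" for f :: "'a::finite_field poly poly"
proof -
  let ?F = "\<lambda>g. poly_Y * act (binv g) f"
  have "poly_X * f = - (\<Sum>g\<in>borel_group. act g poly_Y) * f"
    using trace_poly_Y[where 'a = 'a] by (simp add: borel_trace_def)
  \<comment> \<open>Writing f as g applied to its inverse translate turns each g(Y) f into g applied
    to a single product.\<close>
  also have "\<dots> = - (\<Sum>g\<in>borel_group. act g (?F g))"
    by (simp add: sum_distrib_right act_binv)
  finally have 1: "poly_X * f = - (\<Sum>g\<in>borel_group. act g (?F g))" .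
  have "borel_trace f = (\<Sum>g\<in>borel_group. act (binv g) f)"
    unfolding borel_trace_def
    by (rule sum.reindex_bij_witness[of _ binv binv]) (auto simp: binv_binv binv_in_borel_group)
  then have 2: "borel_trace f * poly_Y = (\<Sum>g\<in>borel_group. ?F g)"
    by (simp add: sum_distrib_left mult.commute)
  \<comment> \<open>Modulo the relations each g may be dropped, and what remains is Y times the sum
    of all inverse translates, the transfer of f.\<close>
  have "poly_X * f + borel_trace f * poly_Y = - (\<Sum>g\<in>borel_group. act g (?F g) - ?F g)"
    unfolding 1 2 sum_subtractf by simp
  also have "\<dots> \<in> cofixed_relations"
    unfolding cofixed_relations_def
    by (intro S.span_neg S.span_sum S.span_base CollectI) blast
  finally show ?thesis .
qed

text \<open>On x = 0 a group element multiplies the coefficient of y^n by d^n, which is 1 when q - 1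
  divides n. These coefficients are thus well-defined functionals on S_B.\<close>

lemma at_x0_cofixed_relations:
  fixes f :: "'a::finite_field poly poly"
  assumes "f \<in> cofixed_relations"
  shows "coeff (at_x0 f) ((CARD('a) - 1) * k) = 0"
  using assms unfolding cofixed_relations_def
proof (induction rule: S.span_induct_alt)
  case (step c e f)
  then obtain g h where g: "g \<in> borel_group" "e = act g h - h" by auto
  then obtain a b d where "g = bmat a b d" "d \<noteq> 0" by (auto elim!: borel_groupE)
  then have "coeff (at_x0 e) ((CARD('a) - 1) * k) = 0"
    by (simp add: g at_x0_act coeff_pcompose_linear power_mult power_card_minus_one
        del: One_nat_def coeff_at_x0)
  with step show ?case by (simp del: coeff_at_x0)
qed simp

text \<open>If q - 1 fails to divide one of the exponents, some torus element scales the monomial by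
  a factor other than 1. Then (factor - 1) times the monomial is a relation, and this scalar is
  invertible.\<close>

lemma monomial_in_cofixed_relations:
  fixes i k :: nat
  assumes "\<not> ((CARD('a) - 1) dvd i \<and> (CARD('a) - 1) dvd k)"
  shows "var_x ^ i * var_y ^ k \<in> (cofixed_relations :: 'a::finite_field poly poly set)"
proof -
  obtain a d :: 'a where ad: "a \<noteq> 0" "d \<noteq> 0" "a ^ i * d ^ k \<noteq> 1"
    using assms unfolding power_eq_one_iff_card_minus_one_dvd[symmetric]
    by (metis mult_1_left mult_1_right power_one zero_neq_one)
  let ?m = "var_x ^ i * var_y ^ k :: 'a poly poly"
  have "act (bmat a 0 d) ?m - ?m = const (a ^ i * d ^ k - 1) * ?m"
  proof -
    have e: "const (a ^ i * d ^ k - 1) = const a ^ i * const d ^ k - 1"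
      using const_add[of "a ^ i * d ^ k - 1" 1] by (simp add: const_mult const_power algebra_simps)
    show ?thesis unfolding e by (simp add: power_mult_distrib algebra_simps)
  qed
  moreover have "act (bmat a 0 d) ?m - ?m \<in> cofixed_relations"
    unfolding cofixed_relations_def
    using ad by (intro S.span_base CollectI exI[of _ "bmat a 0 d"] exI[of _ ?m]) simp
  ultimately have "const (1 / (a ^ i * d ^ k - 1)) * (const (a ^ i * d ^ k - 1) * ?m) \<in> cofixed_relations"
    by (simp only: cofixed_relations_const)
  with ad(3) show ?thesis
    by (simp flip: mult.assoc const_mult)
qed

section \<open>Generators and relations of the cofixed space\<close>

lemma cofixed_class_simps:
  "cofixed_class (f + g) = cofixed_class f + cofixed_class g"
  "cofixed_class (f - g) = cofixed_class f - cofixed_class g"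
  "cofixed_class 0 = 0"
  by (simp_all add: plus_cofixed.abs_eq zero_cofixed_def uminus_cofixed.abs_eq minus_cofixed_def)

lemma cofixed_class_sum: "cofixed_class (\<Sum>i\<in>I. f i) = (\<Sum>i\<in>I. cofixed_class (f i))"
  by (induction I rule: infinite_finite_induct) (simp_all add: cofixed_class_simps)

lemma cofixed_class_const: "cofixed_class (const c * f) = cofixed_field_scale c (cofixed_class f)"
  by (simp add: cofixed_field_scale.abs_eq)

lemma cofixed_class_poly_of:
  "cofixed_class (poly_of r * f) = cofixed_scale r (cofixed_class f)"
  using cofixed_scale.abs_eq[of "poly_of r" f] by (simp add: eq_onp_def poly_of poly_of_inverse)

lemma cofixed_class_eq_0_iff: "cofixed_class f = 0 \<longleftrightarrow> f \<in> cofixed_relations"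
  by (simp add: zero_cofixed_def cofixed.abs_eq_iff)

lemma cofixed_class_poly_X_mult:
  assumes "borel_trace f = 0"
  shows "cofixed_class (poly_X * f) = 0"
  using poly_X_mult_cofixed[of f] assms by (simp add: cofixed_class_eq_0_iff)

text \<open>The images of these elements form an \<open>\<bbbF>\<^sub>q\<close>-basis of the cofixed space; the weight is the
  degree divided by \<open>q - 1\<close>.\<close>

definition basis_elt :: "nat \<times> nat + nat \<times> nat \<Rightarrow> 'a::finite_field poly poly"
  where "basis_elt x = (case x of Inl (i, k) \<Rightarrow> poly_X ^ i * poly_D ^ k * poly_Y
    | Inr (j, k) \<Rightarrow> poly_D ^ k * torsion_gen j)"

definition basis_wt :: "nat \<Rightarrow> nat \<times> nat + nat \<times> nat \<Rightarrow> nat"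
  where "basis_wt q x = (case x of Inl (i, k) \<Rightarrow> i + 1 + q * k | Inr (j, k) \<Rightarrow> j + q * k)"

definition basis_index :: "nat \<Rightarrow> nat \<Rightarrow> (nat \<times> nat + nat \<times> nat) set"
  where "basis_index q d =
    {x \<in> UNIV <+> (insert 0 {2..q - 1} \<times> UNIV). (q - 1) * basis_wt q x = d}"

text \<open>D is monic of degree q in Y, so its definition serves as a rewriting rule that lowers
  powers of Y from q on.\<close>

lemma poly_Y_power_reduce:
  fixes n :: nat
  shows "poly_Y ^ (CARD('a) + n) = poly_D * poly_Y ^ n
    - (\<Sum>l<CARD('a). poly_X ^ (l + 1) * (poly_Y :: 'a::finite_field poly poly) ^ (CARD('a) - 1 - l + n))"
proof -
  have D: "poly_D = poly_Y ^ CARD('a)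
      + (\<Sum>l<CARD('a). poly_X ^ (l + 1) * (poly_Y :: 'a poly poly) ^ (CARD('a) - 1 - l))"
    unfolding poly_D_def by (subst sum.atMost_shift) simp
  have "poly_D * poly_Y ^ n = poly_Y ^ CARD('a) * poly_Y ^ n
      + (\<Sum>l<CARD('a). poly_X ^ (l + 1) * (poly_Y :: 'a poly poly) ^ (CARD('a) - 1 - l) * poly_Y ^ n)"
    using arg_cong[OF D, of "\<lambda>z. z * poly_Y ^ n"]
    by (simp only: distrib_right sum_distrib_right)
  then show ?thesis
    by (simp only: power_add mult.assoc add_diff_cancel_right')
qed

text \<open>Induction on the power of Y. Powers from q on are rewritten through D; for 2 <= j < q
  the power splits into a torsion generator and X^(j-1) Y; and torsion generators, including 1,
  vanish in S_B once multiplied by X. The weight is kept throughout.\<close>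

lemma monomial_in_span_basis:
  fixes i j k n :: nat
  shows "cofixed_class (poly_X ^ i * poly_D ^ k * poly_Y ^ j) \<in>
    cofixed_field.span (cofixed_class `
      (basis_elt :: _ \<Rightarrow> 'a::finite_field poly poly) ` basis_index CARD('a) ((CARD('a) - 1) * (i + j + CARD('a) * k)))"
proof (induction j arbitrary: i k rule: less_induct)
  case (less j)
  define q where "q = CARD('a)"
  define X Y D :: "'a poly poly" where "X = poly_X" and "Y = poly_Y" and "D = poly_D"
  define W where "W n = cofixed_field.span (cofixed_class `
      (basis_elt :: _ \<Rightarrow> 'a poly poly) ` basis_index q ((q - 1) * n))" for n
  have q: "1 < q" using one_less_card_field[where 'a = 'a] by (simp add: q_def)
  have base: "cofixed_class (basis_elt x :: 'a poly poly) \<in> W n"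
    if "x \<in> UNIV <+> (insert 0 {2..q - 1} \<times> UNIV)" "basis_wt q x = n" for x n
    using that unfolding W_def by (intro cofixed_field.span_base imageI) (simp add: basis_index_def)
  have baseL: "cofixed_class (X ^ i * D ^ k * Y) \<in> W n" if "i + 1 + q * k = n" for i k n
    using base[of "Inl (i, k)" n] that
    by (simp add: Plus_def basis_elt_def basis_wt_def X_def Y_def D_def)
  have baseR: "cofixed_class (D ^ k * torsion_gen j) \<in> W n"
    if "j \<in> insert 0 {2..q - 1}" "j + q * k = n" for j k n
    using base[of "Inr (j, k)" n] that
    by (simp add: Plus_def basis_elt_def basis_wt_def D_def)
  have IH: "cofixed_class (X ^ i * D ^ k * Y ^ l) \<in> W n" if "l < j" "i + l + q * k = n" for i k l n
    using less.IH[OF that(1), of i k] that(2) by (simp add: X_def Y_def D_def W_def q_def)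
  \<comment> \<open>One factor X is split off; the remaining invariant factor leaves the transfer
    zero, so multiplication by X gives a relation.\<close>
  have vanish: "cofixed_class (X ^ i * D ^ k * f) \<in> W n"
    if pos: "0 < i" and tr: "borel_trace f = 0" for i k f n
  proof -
    obtain i' where i: "i = Suc i'" using pos by (cases i) auto
    have "X ^ i' * D ^ k \<in> invariants"
      using poly_X_invariant[where 'a = 'a] poly_D_invariant[where 'a = 'a]
      by (simp add: invariants_def X_def D_def)
    then have "borel_trace (X ^ i' * D ^ k * f) = 0"
      using tr by (simp add: trace_invariant_mult)
    then have "cofixed_class (X * (X ^ i' * D ^ k * f)) = 0"
      unfolding X_def by (rule cofixed_class_poly_X_mult)
    then show ?thesis
      using cofixed_field.span_zero by (simp add: i W_def mult.assoc)
  qed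
  have "cofixed_class (X ^ i * D ^ k * Y ^ j) \<in> W (i + j + q * k)"
  proof -
    consider "q \<le> j" | "j = 1" | "j = 0" | "2 \<le> j" "j < q" by linarith
    then show ?thesis
    proof cases
      case 1
      then obtain m where m: "j = q + m" using le_Suc_ex by blast
      \<comment> \<open>Every power of Y on the right is smaller than Y^j, and all terms have the
        same weight.\<close>
      have e: "X ^ i * D ^ k * Y ^ j = X ^ i * D ^ (k + 1) * Y ^ m
          - (\<Sum>l<q. X ^ (i + l + 1) * D ^ k * Y ^ (q - 1 - l + m))"
        unfolding m q_def X_def Y_def D_def poly_Y_power_reduce
        by (simp add: sum_distrib_left right_diff_distrib power_add mult_ac)
      have "cofixed_class (X ^ i * D ^ (k + 1) * Y ^ m) \<in> W (i + j + q * k)"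
        by (rule IH) (use q in \<open>auto simp: m\<close>)
      moreover have "cofixed_class (X ^ (i + l + 1) * D ^ k * Y ^ (q - 1 - l + m)) \<in> W (i + j + q * k)"
        if "l < q" for l
        by (rule IH) (use that in \<open>auto simp: m\<close>)
      ultimately show ?thesis
        unfolding e cofixed_class_simps cofixed_class_sum W_def
        by (intro cofixed_field.span_diff cofixed_field.span_sum) auto
    next
      case 2
      then show ?thesis
        using baseL[of i k] by simp
    next
      case 3
      show ?thesis
      proof (cases "i = 0")
        case True
        with 3 show ?thesis
          using baseR[of 0 k] by (simp add: torsion_gen_def)
      next
        case False
        then show ?thesis using vanish[of i 1] 3 by (simp add: trace_1)
      qed
    next
      case 4
      have "Y ^ j = torsion_gen j + X ^ (j - 1) * Y"
        using 4 by (simp add: torsion_gen_def X_def Y_def)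
      then have e: "X ^ i * D ^ k * Y ^ j = X ^ i * D ^ k * torsion_gen j + X ^ (i + (j - 1)) * D ^ k * Y"
        by (simp add: power_add algebra_simps)
      have "cofixed_class (X ^ (i + (j - 1)) * D ^ k * Y) \<in> W (i + j + q * k)"
        using 4 by (intro baseL) simp
      moreover have "cofixed_class (X ^ i * D ^ k * torsion_gen j) \<in> W (i + j + q * k)"
      proof (cases "i = 0")
        case True
        then show ?thesis
          using baseR[of j k] 4 by simp
      next
        case False
        then show ?thesis using 4 by (intro vanish trace_torsion_gen) (auto simp: q_def)
      qed
      ultimately show ?thesis
        unfolding e cofixed_class_simps W_def by (intro cofixed_field.span_add)
    qed
  qed
  then show ?case by (simp only: W_def X_def Y_def D_def q_def)
qed

text \<open>A monomial either vanishes in S_B by its torus weight or is of the form X^k Y^l, the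
  case without D of the preceding induction.\<close>

lemma homogeneous_in_span_basis:
  fixes f :: "'a::finite_field poly poly"
  assumes "f \<in> homogeneous d"
  shows "cofixed_class f \<in> cofixed_field.span (cofixed_class `
      (basis_elt :: _ \<Rightarrow> 'a poly poly) ` basis_index CARD('a) d)" (is "_ \<in> ?W")
proof -
  have "cofixed_class (const (coeff (coeff f j) i) * (var_x ^ i * var_y ^ j)) \<in> ?W" for i j
  proof (cases "coeff (coeff f j) i = 0")
    case True
    then show ?thesis by (simp add: cofixed_class_simps cofixed_field.span_zero)
  next
    case False
    with assms have d: "i + j = d" by (auto simp: homogeneous_def)
    have "cofixed_class (var_x ^ i * var_y ^ j) \<in> ?W"
    proof (cases "(CARD('a) - 1) dvd i \<and> (CARD('a) - 1) dvd j")
      case True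
      then obtain k l where kl: "i = (CARD('a) - 1) * k" "j = (CARD('a) - 1) * l"
        by (auto elim!: dvdE)
      have "var_x ^ i * var_y ^ j = poly_X ^ k * poly_D ^ 0 * (poly_Y :: 'a poly poly) ^ l"
        by (simp add: kl poly_X_def poly_Y_def power_mult)
      moreover have "d = (CARD('a) - 1) * (k + l + CARD('a) * 0)"
        unfolding d[symmetric] kl by (simp only: mult_0_right add_0_right distrib_left)
      ultimately show ?thesis
        using monomial_in_span_basis[of k 0 l, where 'a = 'a] by simp
    next
      case False
      then have "cofixed_class (var_x ^ i * var_y ^ j :: 'a poly poly) = 0"
        by (simp only: cofixed_class_eq_0_iff monomial_in_cofixed_relations not_False_eq_True)
      then show ?thesis by (simp add: cofixed_field.span_zero)
    qed
    then show ?thesis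
      unfolding cofixed_class_const by (rule cofixed_field.span_scale)
  qed
  then show ?thesis
    by (subst poly2_as_sum[of f])
      (auto simp only: cofixed_class_sum mult.assoc intro!: cofixed_field.span_sum)
qed

lemma coeff_pcompose_monom:
  fixes c :: "'a::comm_ring_1 poly"
  assumes "0 < m"
  shows "coeff (pcompose c (monom 1 m)) n = (if m dvd n then coeff c (n div m) else 0)"
proof (induction c arbitrary: n)
  case (pCons a c)
  show ?case
  proof (cases "n < m")
    case True
    then show ?thesis
      using assms by (cases n) (auto simp: pcompose_pCons coeff_monom_mult coeff_pCons dest: dvd_imp_le)
  next
    case False
    then obtain l where "n = m + l" by (metis le_Suc_ex not_less)
    with assms pCons show ?thesis
      by (cases n) (auto simp: pcompose_pCons coeff_monom_mult coeff_pCons split: nat.splits)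
  qed
qed simp

lemma at_x0_torsion_gen:
  assumes "j \<in> insert 0 {2..CARD('a) - 1}"
  shows "at_x0 (torsion_gen j :: 'a::finite_field poly poly) = monom 1 ((CARD('a) - 1) * j)"
  using assms by (auto simp: torsion_gen_def monom_power mult.commute power_0_left)

text \<open>The transfer kills the torsion part and turns r Y into -r X, so r = 0. On x = 0 each s j
  is a polynomial in y^(q(q-1)) and the j-th generator is y^((q-1)j); since j < q, these terms lie
  in different residue classes and cannot cancel.\<close>

lemma cofixed_relations_module_independent:
  fixes r :: "'a::finite_field poly poly"
  defines "J \<equiv> insert 0 {2..CARD('a) - 1}"
  assumes r: "r \<in> invariants" and s: "\<And>j. j \<in> J \<Longrightarrow> s j \<in> invariants"
    and rel: "r * poly_Y + (\<Sum>j\<in>J. s j * torsion_gen j) \<in> cofixed_relations"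
  shows "r = 0" "\<And>j. j \<in> J \<Longrightarrow> at_x0 (s j) = 0"
proof -
  define q where "q = CARD('a)"
  have q: "1 < q" using one_less_card_field[where 'a = 'a] by (simp add: q_def)
  have [simp]: "finite J" by (simp add: J_def)
  have "borel_trace (s j * torsion_gen j) = 0" if "j \<in> J" for j
    using that s trace_torsion_gen[of j, where 'a = 'a] by (simp add: trace_invariant_mult J_def)
  moreover have "borel_trace (\<Sum>j\<in>J. s j * torsion_gen j) = (\<Sum>j\<in>J. borel_trace (s j * torsion_gen j))"
    by (simp add: borel_trace_def sum.swap[of _ _ borel_group])
  ultimately have "borel_trace (r * poly_Y) = 0"
    using trace_cofixed_relations[OF rel] by simp
  then show r0: "r = 0"
    by (simp add: trace_invariant_mult[OF r] trace_poly_Y poly_X_neq_0)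
  have "\<exists>c. at_x0 (s j) = pcompose c (monom 1 (q * (q - 1)))" if j: "j \<in> J" for j
  proof -
    obtain G where "s j = subst2 poly_D poly_X G"
      using s[OF j] unfolding range_subst2_poly_D_poly_X[symmetric] by auto
    then show ?thesis unfolding q_def by (auto simp only: at_x0_subst2)
  qed
  then obtain c where c: "at_x0 (s j) = pcompose (c j) (monom 1 (q * (q - 1)))" if "j \<in> J" for j
    by metis
  show "at_x0 (s j) = 0" if j: "j \<in> J" for j
  proof -
    have "coeff (c j) k = 0" for k
    proof -
      \<comment> \<open>The degree in which the k-th power of y^(q(q-1)) meets the j-th
        generator.\<close>
      define n where "n = (q - 1) * (q * k + j)"
      have "0 = coeff (at_x0 (\<Sum>i\<in>J. s i * torsion_gen i)) n"
        using at_x0_cofixed_relations[OF rel, of "q * k + j"] by (simp add: r0 n_def q_def)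
      also have "\<dots> = (\<Sum>i\<in>J. coeff (pcompose (c i) (monom 1 (q * (q - 1))) * monom 1 ((q - 1) * i)) n)"
        unfolding at_x0_sum at_x0_simps coeff_sum
        by (intro sum.cong refl arg_cong2[where f = coeff] arg_cong2[where f = "(*)"])
          (simp_all add: c J_def q_def at_x0_torsion_gen)
      also have "\<dots> = (\<Sum>i\<in>J. if i = j then coeff (c j) k else 0)"
      proof (rule sum.cong)
        fix i assume i: "i \<in> J"
        have ij: "i < q" "j < q" using i j q by (auto simp: J_def q_def)
        have *: "coeff (pcompose (c i) (monom 1 (q * (q - 1))) * monom 1 ((q - 1) * i)) n =
          (if n < (q - 1) * i then 0 else coeff (pcompose (c i) (monom 1 (q * (q - 1)))) (n - (q - 1) * i))"
          by (subst mult.commute) (simp add: coeff_monom_mult)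
        show "coeff (pcompose (c i) (monom 1 (q * (q - 1))) * monom 1 ((q - 1) * i)) n =
          (if i = j then coeff (c j) k else 0)"
        proof (cases "n < (q - 1) * i")
          case True
          then have "q * k + j < i" by (simp add: n_def)
          with True * show ?thesis by auto
        next
          case False
          then have le: "i \<le> q * k + j" using q by (simp add: n_def)
          have d: "n - (q - 1) * i = (q - 1) * (q * k + j - i)"
            by (simp add: n_def diff_mult_distrib2)
          \<comment> \<open>After cancelling q - 1, the i-th term reaches degree n only if i and j
            agree modulo q, and both are below q.\<close>
          have "q * (q - 1) dvd n - (q - 1) * i \<longleftrightarrow> q dvd (q * k + j - i)"
            unfolding d using q by (simp add: mult.commute[of q])
          also have "\<dots> \<longleftrightarrow> i = j"
          proof
            assume "q dvd (q * k + j - i)"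
            then obtain t where "q * k + j - i = q * t" ..
            with le have "q * k + j = q * t + i" by linarith
            from arg_cong[OF this, of "\<lambda>n. n mod q"] ij show "i = j" by simp
          qed simp
          finally have "q * (q - 1) dvd n - (q - 1) * i \<longleftrightarrow> i = j" .
          moreover have "(n - (q - 1) * i) div (q * (q - 1)) = k" if "i = j"
            unfolding d using q that by (simp add: mult.commute[of q "q - 1"])
          ultimately show ?thesis
            using False * q by (simp add: coeff_pcompose_monom)
        qed
      qed simp
      also have "\<dots> = coeff (c j) k" using j by simp
      finally show ?thesis by simp
    qed
    then have "c j = 0" by (simp add: poly_eq_iff)
    then show ?thesis using c[OF j] by simp
  qed
qed

section \<open>Graded dimensions\<close>

lemma homogeneous_add: "f \<in> homogeneous d \<Longrightarrow> g \<in> homogeneous d \<Longrightarrow> f + g \<in> homogeneous d"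
  unfolding homogeneous_def by (auto, metis add_0)

lemma homogeneous_diff: "f \<in> homogeneous d \<Longrightarrow> g \<in> homogeneous d \<Longrightarrow> f - g \<in> homogeneous d"
  unfolding homogeneous_def by (auto, metis diff_0_right)

lemma homogeneous_0: "0 \<in> homogeneous d"
  by (simp add: homogeneous_def)

lemma homogeneous_sum: "(\<And>i. i \<in> I \<Longrightarrow> f i \<in> homogeneous d) \<Longrightarrow> (\<Sum>i\<in>I. f i) \<in> homogeneous d"
  by (induction I rule: infinite_finite_induct) (auto intro: homogeneous_add homogeneous_0)

lemma homogeneous_mult:
  assumes "f \<in> homogeneous d" "g \<in> homogeneous e"
  shows "f * g \<in> homogeneous (d + e)"
  unfolding homogeneous_def
proof (intro CollectI allI impI)
  fix i j
  assume "coeff (coeff (f * g) j) i \<noteq> 0"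
  then have "(\<Sum>k\<le>j. \<Sum>l\<le>i. coeff (coeff f k) l * coeff (coeff g (j - k)) (i - l)) \<noteq> 0"
    by (simp add: coeff_mult coeff_sum)
  then obtain k l where kl: "k \<le> j" "l \<le> i" "coeff (coeff f k) l * coeff (coeff g (j - k)) (i - l) \<noteq> 0"
    by (metis (no_types, lifting) sum.neutral atMost_iff)
  then have "coeff (coeff f k) l \<noteq> 0" "coeff (coeff g (j - k)) (i - l) \<noteq> 0"
    by auto
  with assms have "l + k = d" "(i - l) + (j - k) = e"
    by (auto simp: homogeneous_def)
  with kl show "i + j = d + e" by linarith
qed

lemma homogeneous_power: "f \<in> homogeneous d \<Longrightarrow> f ^ n \<in> homogeneous (d * n)"
proof (induction n)
  case 0
  then show ?case
    by (auto simp: homogeneous_def one_pCons coeff_pCons split: nat.splits)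
next
  case (Suc n)
  then show ?case using homogeneous_mult[of f d "f ^ n" "d * n"] by simp
qed

lemma homogeneous_var_x: "var_x \<in> homogeneous 1" and homogeneous_var_y: "var_y \<in> homogeneous 1"
  by (auto simp: homogeneous_def var_x_def var_y_def coeff_pCons split: nat.splits)

lemma homogeneous_poly_X: "(poly_X :: 'a::finite_field poly poly) \<in> homogeneous (CARD('a) - 1)"
  and homogeneous_poly_Y: "(poly_Y :: 'a poly poly) \<in> homogeneous (CARD('a) - 1)"
  unfolding poly_X_def poly_Y_def
  using homogeneous_power[OF homogeneous_var_x] homogeneous_power[OF homogeneous_var_y]
  by (metis mult_1)+

lemma homogeneous_poly_D:
  "(poly_D :: 'a::finite_field poly poly) \<in> homogeneous ((CARD('a) - 1) * CARD('a))"
  unfolding poly_D_def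
proof (rule homogeneous_sum)
  fix i assume "i \<in> {..CARD('a)}"
  then have "(CARD('a) - 1) * CARD('a) = (CARD('a) - 1) * i + (CARD('a) - 1) * (CARD('a) - i)"
    by (simp flip: distrib_left)
  then show "poly_X ^ i * (poly_Y :: 'a poly poly) ^ (CARD('a) - i) \<in> homogeneous ((CARD('a) - 1) * CARD('a))"
    by (simp only: homogeneous_mult homogeneous_power homogeneous_poly_X homogeneous_poly_Y)
qed

lemma homogeneous_torsion_gen:
  assumes "j \<in> insert 0 {2..CARD('a) - 1}"
  shows "(torsion_gen j :: 'a::finite_field poly poly) \<in> homogeneous ((CARD('a) - 1) * j)"
proof (cases "j = 0")
  case True
  then show ?thesis
    by (auto simp: torsion_gen_def homogeneous_def one_pCons coeff_pCons split: nat.splits)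
next
  case False
  have "(CARD('a) - 1) * j = (CARD('a) - 1) * (j - 1) + (CARD('a) - 1)"
    using False by (cases j) simp_all
  then have "poly_X ^ (j - 1) * (poly_Y :: 'a poly poly) \<in> homogeneous ((CARD('a) - 1) * j)"
    by (simp only: homogeneous_mult homogeneous_power homogeneous_poly_X homogeneous_poly_Y)
  then show ?thesis
    using False homogeneous_power[OF homogeneous_poly_Y[where 'a = 'a], of j]
    by (simp add: torsion_gen_def homogeneous_diff)
qed

lemma homogeneous_basis_elt:
  assumes "x \<in> basis_index CARD('a) d"
  shows "(basis_elt x :: 'a::finite_field poly poly) \<in> homogeneous d"
proof (cases x)
  case (Inl p)
  obtain i k where p: "p = (i, k)" by force
  have d: "d = (CARD('a) - 1) * i + ((CARD('a) - 1) * CARD('a)) * k + (CARD('a) - 1)"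
    using assms by (simp add: Inl p basis_index_def basis_wt_def) (simp add: algebra_simps)
  show ?thesis
    unfolding d by (simp only: Inl p basis_elt_def sum.case prod.case homogeneous_mult
      homogeneous_power homogeneous_poly_X homogeneous_poly_Y homogeneous_poly_D)
next
  case (Inr p)
  obtain j k where p: "p = (j, k)" by force
  have j: "j \<in> insert 0 {2..CARD('a) - 1}"
    and d: "d = ((CARD('a) - 1) * CARD('a)) * k + (CARD('a) - 1) * j"
    using assms by (auto simp: Inr p basis_index_def basis_wt_def Plus_def algebra_simps)
  show ?thesis
    unfolding d by (simp only: Inr p basis_elt_def sum.case prod.case homogeneous_mult
      homogeneous_power homogeneous_poly_D homogeneous_torsion_gen[OF j])
qed

section \<open>Linear independence and the dimensions of the graded pieces\<close>

lemma coeff2_monomial: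
  "coeff (coeff (var_y ^ i * var_x ^ k) j) l = (if i = j \<and> k = l then 1 else 0)"
  by (auto simp: var_x_power var_y_power mult.commute[of "monom 1 i"])

text \<open>The scalars are collected into coefficients from S^B: G belongs to Y, and H j to the
  j-th torsion generator. Independence over S^B gives G = 0 and makes X divide the value of H j; as
  H j involves D only, it vanishes as well.\<close>

lemma basis_elt_scalars_zero:
  fixes c :: "nat \<times> nat + nat \<times> nat \<Rightarrow> 'a::finite_field"
  assumes "finite I" "I \<subseteq> UNIV <+> (insert 0 {2..CARD('a) - 1} \<times> UNIV)"
    and zero: "(\<Sum>x\<in>I. cofixed_field_scale (c x) (cofixed_class (basis_elt x))) = 0"
    and "x \<in> I"
  shows "c x = 0"
proof -
  define J where "J = insert 0 {2..CARD('a) - 1}"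
  define I1 where "I1 = {p. Inl p \<in> I}"
  define K where "K j = {k. Inr (j, k) \<in> I}" for j
  have I: "I = I1 <+> Sigma J K"
    using assms(2) by (force simp: I1_def K_def J_def Plus_def)
  have fin: "finite I1" "finite J" "finite (K j)" for j
    using assms(1) by (auto simp: I1_def J_def K_def inj_def vimage_def[symmetric]
        intro: finite_vimageI finite_vimageI[of _ "\<lambda>k. Inr (j, k)", unfolded vimage_def])
  \<comment> \<open>The substitution sends y to X and x to D, which explains the order of the
    variables.\<close>
  define G :: "'a poly poly" where "G = (\<Sum>(i, k)\<in>I1. const (c (Inl (i, k))) * (var_y ^ i * var_x ^ k))"
  define H :: "nat \<Rightarrow> 'a poly poly" where "H j = (\<Sum>k\<in>K j. const (c (Inr (j, k))) * var_x ^ k)" for j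
  have "(\<Sum>x\<in>I. const (c x) * basis_elt x) =
      subst2 poly_D poly_X G * poly_Y + (\<Sum>j\<in>J. subst2 poly_D poly_X (H j) * torsion_gen j)"
  proof -
    have "(\<Sum>x\<in>I. const (c x) * basis_elt x) =
        (\<Sum>(i, k)\<in>I1. const (c (Inl (i, k))) * basis_elt (Inl (i, k)))
        + (\<Sum>(j, k)\<in>Sigma J K. const (c (Inr (j, k))) * basis_elt (Inr (j, k)))"
      unfolding I using fin by (subst sum.Plus) (auto simp: split_def comp_def)
    also have "(\<Sum>(j, k)\<in>Sigma J K. const (c (Inr (j, k))) * basis_elt (Inr (j, k))) =
        (\<Sum>j\<in>J. \<Sum>k\<in>K j. const (c (Inr (j, k))) * basis_elt (Inr (j, k)))"
      using fin by (intro sum.Sigma[symmetric]) auto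
    finally show ?thesis
      by (simp add: G_def H_def basis_elt_def subst2_sum subst2_mult subst2_power split_def
          sum_distrib_left sum_distrib_right mult_ac)
  qed
  moreover have "(\<Sum>x\<in>I. const (c x) * basis_elt x) \<in> cofixed_relations"
    using zero by (simp add: cofixed_class_sum cofixed_class_const flip: cofixed_class_eq_0_iff)
  ultimately have rel: "subst2 poly_D poly_X G * poly_Y
      + (\<Sum>j\<in>J. subst2 poly_D poly_X (H j) * torsion_gen j) \<in> cofixed_relations"
    by simp
  have inv: "subst2 poly_D poly_X F \<in> invariants" for F :: "'a poly poly"
    by (simp flip: range_subst2_poly_D_poly_X)
  have "G = 0"
    using cofixed_relations_module_independent(1)[OF inv inv rel[unfolded J_def]]
    by (rule subst2_poly_D_poly_X_eq_0)
  \<comment> \<open>The coefficient at 0 is all of H j for the purpose of its scalars, because H j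
    is constant in the outer variable.\<close>
  have H0: "coeff (H j) 0 = 0" if "j \<in> J" for j
    using cofixed_relations_module_independent(2)[OF inv inv rel[unfolded J_def]] that
    by (simp add: J_def flip: at_x0_subst2_eq_0_iff)
  from \<open>x \<in> I\<close> consider i k where "x = Inl (i, k)" "(i, k) \<in> I1"
    | j k where "x = Inr (j, k)" "j \<in> J" "k \<in> K j"
    unfolding I by auto
  then show ?thesis
  proof cases
    case 1
    have "0 = coeff (coeff G i) k" by (simp add: \<open>G = 0\<close>)
    also have "\<dots> = (\<Sum>p\<in>I1. if p = (i, k) then c (Inl p) else 0)"
      unfolding G_def coeff_sum split_def
      by (intro sum.cong refl) (auto simp: coeff2_simps coeff2_monomial)
    also have "\<dots> = c x" using 1 fin by simp
    finally show ?thesis by simp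
  next
    case 2
    have "0 = coeff (coeff (H j) 0) k" by (simp add: H0 2)
    also have "\<dots> = (\<Sum>l\<in>K j. if l = k then c (Inr (j, l)) else 0)"
      unfolding H_def coeff_sum
      using coeff2_monomial[of 0 _ 0, where 'a = 'a]
      by (intro sum.cong refl) (auto simp: coeff2_simps)
    also have "\<dots> = c x" using 2 fin by simp
    finally show ?thesis by simp
  qed
qed

text \<open>With scalars attached to indices rather than to vectors, the hypothesis also excludes
  repetitions in the family.\<close>

lemma (in vector_space) independent_family:
  assumes "finite I" "\<And>c i. (\<Sum>i\<in>I. scale (c i) (v i)) = 0 \<Longrightarrow> i \<in> I \<Longrightarrow> c i = 0"
  shows "inj_on v I" "independent (v ` I)"
proof -
  show inj: "inj_on v I"
  proof (rule inj_onI, rule ccontr)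
    fix i j assume ij: "i \<in> I" "j \<in> I" "v i = v j" "i \<noteq> j"
    \<comment> \<open>For a repeated vector, coefficient 1 at i and -1 at j gives a nontrivial
      relation.\<close>
    define c :: "'c \<Rightarrow> 'a" where "c k = (if k = i then 1 else 0) - (if k = j then 1 else 0)" for k
    have "(\<Sum>k\<in>I. scale (c k) (v k)) =
        (\<Sum>k\<in>I. if k = i then v k else 0) - (\<Sum>k\<in>I. if k = j then v k else 0)"
      unfolding c_def scale_left_diff_distrib sum_subtractf
      by (intro arg_cong2[where f = "(-)"] sum.cong) auto
    also have "\<dots> = 0" using ij assms(1) by simp
    finally have "c i = 0" using ij(1) by (rule assms(2))
    with ij(4) show False by (simp add: c_def)
  qed
  show "independent (v ` I)"
  proof (rule independent_if_scalars_zero)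
    fix f x assume *: "(\<Sum>x\<in>v ` I. scale (f x) x) = 0" and "x \<in> v ` I"
    then obtain i where "i \<in> I" "x = v i" by auto
    moreover from * have "(\<Sum>i\<in>I. scale (f (v i)) (v i)) = 0"
      by (simp add: sum.reindex[OF inj])
    ultimately show "f x = 0" using assms(2)[of "f \<circ> v" i] by simp
  qed (simp add: assms(1))
qed

lemma finite_basis_index:
  assumes "1 < q"
  shows "finite (basis_index q d)"
proof (rule finite_subset)
  have le: "n \<le> (q - 1) * n" for n
  proof -
    have "1 \<le> q - 1" using assms by linarith
    then show ?thesis using mult_le_mono1[of 1 "q - 1" n] by linarith
  qed
  show "basis_index q d \<subseteq> ({..d} \<times> {..d}) <+> ({..d} \<times> {..d})"
  proof
    fix x assume x: "x \<in> basis_index q d"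
    then have wt: "basis_wt q x \<le> d"
      using le[of "basis_wt q x"] by (simp add: basis_index_def)
    have "k \<le> q * k" for k using assms by simp
    then have bound: "i \<le> d \<and> k \<le> d" if "i + q * k \<le> d" for i k
      using that by (meson add_leD1 add_leD2 le_trans)
    show "x \<in> ({..d} \<times> {..d}) <+> ({..d} \<times> {..d})"
    proof (cases x)
      case (Inl p)
      obtain i k where "p = (i, k)" by force
      with wt show ?thesis
        using bound[of i k] by (simp add: Inl basis_wt_def Plus_def)
    next
      case (Inr p)
      obtain j k where "p = (j, k)" by force
      with wt show ?thesis
        using bound[of j k] by (simp add: Inr basis_wt_def Plus_def)
    qed
  qed
qed simp

lemma dim_cofixed_piece:
  "cofixed_field.dim (cofixed_piece d :: 'a::finite_field cofixed set) = card (basis_index CARD('a) d)"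
proof -
  let ?v = "\<lambda>x. cofixed_class (basis_elt x) :: 'a cofixed"
  let ?I = "basis_index CARD('a) d"
  have fin: "finite ?I" by (intro finite_basis_index one_less_card_field)
  have "inj_on ?v ?I" "cofixed_field.independent (?v ` ?I)"
    using fin basis_elt_scalars_zero[OF fin, where 'a = 'a]
    by (intro cofixed_field.independent_family; simp add: basis_index_def)+
  then show ?thesis
    using homogeneous_basis_elt[where 'a = 'a] homogeneous_in_span_basis[where 'a = 'a]
    by (intro cofixed_field.dim_unique[of "?v ` ?I"])
      (auto simp: cofixed_piece_def card_image image_image)
qed

section \<open>Generating functions of weighted sets\<close>

definition count_fps :: "'b set \<Rightarrow> ('b \<Rightarrow> nat) \<Rightarrow> rat fps"
  where "count_fps A w = Abs_fps (\<lambda>d. of_nat (card {x \<in> A. w x = d}))"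

lemma count_fps_nth [simp]: "fps_nth (count_fps A w) d = of_nat (card {x \<in> A. w x = d})"
  by (simp add: count_fps_def)

lemma count_fps_Plus:
  assumes "\<And>d. finite {x \<in> A. w (Inl x) = d}" "\<And>d. finite {x \<in> B. w (Inr x) = d}"
  shows "count_fps (A <+> B) w = count_fps A (\<lambda>x. w (Inl x)) + count_fps B (\<lambda>x. w (Inr x))"
proof (rule fps_ext)
  fix d
  have "{x \<in> A <+> B. w x = d} = {x \<in> A. w (Inl x) = d} <+> {x \<in> B. w (Inr x) = d}"
    by auto
  then show "fps_nth (count_fps (A <+> B) w) d = fps_nth (count_fps A (\<lambda>x. w (Inl x)) + count_fps B (\<lambda>x. w (Inr x))) d"
    using assms by (simp add: card_Plus)
qed

text \<open>The pairs of weight d are split by the weight of the first component, which is the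
  Cauchy product.\<close>

lemma count_fps_Times:
  assumes "\<And>d. finite {x \<in> A. u x = d}" "\<And>d. finite {y \<in> B. v y = d}"
  shows "count_fps (A \<times> B) (\<lambda>(x, y). u x + v y) = count_fps A u * count_fps B v"
proof (rule fps_ext)
  fix d
  have "{p \<in> A \<times> B. (case p of (x, y) \<Rightarrow> u x + v y) = d} =
      (\<Union>a\<in>{0..d}. {x \<in> A. u x = a} \<times> {y \<in> B. v y = d - a})"
    by auto
  also have "card \<dots> = (\<Sum>a=0..d. card ({x \<in> A. u x = a} \<times> {y \<in> B. v y = d - a}))"
    using assms by (intro card_UN_disjoint) auto
  finally show "fps_nth (count_fps (A \<times> B) (\<lambda>(x, y). u x + v y)) d = fps_nth (count_fps A u * count_fps B v) d"
    by (simp add: fps_mult_nth card_cartesian_product)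
qed

lemma count_fps_finite:
  assumes "finite A"
  shows "count_fps A w = (\<Sum>x\<in>A. fps_X ^ w x)"
proof (rule fps_ext)
  fix d
  have "fps_nth (\<Sum>x\<in>A. fps_X ^ w x) d = (\<Sum>x\<in>A. if w x = d then 1 else 0 :: rat)"
    by (simp add: fps_sum_nth fps_X_power_nth eq_commute)
  also have "\<dots> = of_nat (card {x \<in> A. w x = d})"
    using assms by (simp add: sum.If_cases Int_def)
  finally show "fps_nth (count_fps A w) d = fps_nth (\<Sum>x\<in>A. fps_X ^ w x) d" by simp
qed

lemma count_fps_add: "count_fps A (\<lambda>x. n + w x) = fps_X ^ n * count_fps A w"
proof (rule fps_ext)
  fix d
  have "{x \<in> A. n + w x = d} = (if d < n then {} else {x \<in> A. w x = d - n})"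
    by auto
  then show "fps_nth (count_fps A (\<lambda>x. n + w x)) d = fps_nth (fps_X ^ n * count_fps A w) d"
    by (simp add: fps_X_power_mult_nth)
qed

text \<open>Splitting off k = 0 and shifting the rest by \<open>Suc\<close> shows that the series F
  satisfies F = 1 + t^m F.\<close>

lemma count_fps_multiples:
  assumes "0 < m"
  shows "count_fps (UNIV :: nat set) (\<lambda>k. m * k) = inverse (1 - fps_X ^ m)"
proof -
  have card: "card {k. m * k = d} = (if d = 0 then 1 else if d < m then 0 else card {k. m * k = d - m})" for d
  proof -
    consider "d = 0" | "0 < d" "d < m" | "m \<le> d" "0 < d" using assms by linarith
    then show ?thesis
    proof cases
      case 3
      have "bij_betw Suc {k. m * k = d - m} {k. m * k = d}"
        unfolding bij_betw_def
      proof
        show "Suc ` {k. m * k = d - m} = {k. m * k = d}"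
        proof (intro equalityI subsetI)
          fix k assume "k \<in> {k. m * k = d}"
          then have "m * k = d" by simp
          with 3 show "k \<in> Suc ` {k. m * k = d - m}"
            by (cases k) auto
        qed (use 3 in auto)
      qed simp
      then have "card {k. m * k = d - m} = card {k. m * k = d}"
        by (rule bij_betw_same_card)
      then show ?thesis using 3 by simp
    qed (use assms in \<open>auto simp: card_eq_0_iff\<close>)
  qed
  have "count_fps (UNIV :: nat set) (\<lambda>k. m * k) = 1 + fps_X ^ m * count_fps (UNIV :: nat set) (\<lambda>k. m * k)"
  proof (rule fps_ext)
    fix d
    show "fps_nth (count_fps (UNIV :: nat set) (\<lambda>k. m * k)) d =
        fps_nth (1 + fps_X ^ m * count_fps (UNIV :: nat set) (\<lambda>k. m * k)) d"
      using assms card[of d] by (simp add: fps_X_power_mult_nth)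
  qed
  then have "(1 - fps_X ^ m) * count_fps (UNIV :: nat set) (\<lambda>k. m * k) = 1"
    by (simp add: algebra_simps)
  then show ?thesis
    by (metis fps_inverse_unique)
qed

section \<open>The module structure and the Hilbert series\<close>

lemma finite_multiples_fibre: "0 < (m :: nat) \<Longrightarrow> finite {k. n + m * k = d}"
  by (rule finite_subset[of _ "{..d}"]) (auto simp: trans_le_add2)

text \<open>The index set is a disjoint union of two products on which the degree is additive, with
  steps q - 1 for X and q^2 - q for D. The extra factor in the first summand is the degree of
  Y.\<close>

lemma Hilb_cofixed_piece:
  fixes q :: nat
  defines "q \<equiv> CARD('a::finite_field)"
  shows "Hilb (cofixed_piece :: nat \<Rightarrow> 'a cofixed set) =
    fps_X ^ (q - 1) * inverse (1 - fps_X ^ (q - 1)) * inverse (1 - fps_X ^ (q\<^sup>2 - q))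
    + (1 + (\<Sum>j = 2..q - 1. fps_X ^ (j * (q - 1)))) * inverse (1 - fps_X ^ (q\<^sup>2 - q))"
proof -
  have q: "1 < q" unfolding q_def by (rule one_less_card_field)
  define m M where "m = q - 1" and "M = q\<^sup>2 - q"
  have mM: "0 < m" "0 < M" "M = m * q"
    using q by (simp_all add: m_def M_def power2_eq_square diff_mult_distrib)
  let ?J = "insert 0 {2..q - 1}"
  have "Hilb (cofixed_piece :: nat \<Rightarrow> 'a cofixed set) =
      count_fps (UNIV <+> (?J \<times> UNIV)) (\<lambda>x. m * basis_wt q x)"
    by (rule fps_ext) (simp add: Hilb_def dim_cofixed_piece basis_index_def m_def q_def)
  also have "\<dots> = count_fps UNIV (\<lambda>x. m * basis_wt q (Inl x))
      + count_fps (?J \<times> UNIV) (\<lambda>x. m * basis_wt q (Inr x))"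
  proof (rule count_fps_Plus)
    fix d
    have fin: "finite (basis_index q d)" by (rule finite_basis_index[OF q])
    show "finite {x \<in> UNIV. m * basis_wt q (Inl x) = d}"
      by (rule finite_subset[OF _ finite_vimageI[OF fin, of Inl]]) (auto simp: basis_index_def m_def)
    show "finite {x \<in> ?J \<times> UNIV. m * basis_wt q (Inr x) = d}"
      by (rule finite_subset[OF _ finite_vimageI[OF fin, of Inr]]) (auto simp: basis_index_def m_def)
  qed
  also have "(\<lambda>x. m * basis_wt q (Inl x)) = (\<lambda>(i, k). (m + m * i) + M * k)"
    by (auto simp: basis_wt_def mM algebra_simps)
  also have "count_fps UNIV \<dots> = count_fps UNIV (\<lambda>i. m + m * i) * count_fps UNIV (\<lambda>k. M * k)"
    using mM finite_multiples_fibre[of M 0] finite_multiples_fibre[of m]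
    by (subst count_fps_Times[symmetric]) simp_all
  also have "count_fps UNIV (\<lambda>i. m + m * i) = fps_X ^ m * count_fps UNIV (\<lambda>i. m * i)"
    by (rule count_fps_add)
  also have "(\<lambda>x. m * basis_wt q (Inr x)) = (\<lambda>(j, k). j * m + M * k)"
    by (auto simp: basis_wt_def mM algebra_simps)
  also have "count_fps (?J \<times> UNIV) \<dots> = count_fps ?J (\<lambda>j. j * m) * count_fps UNIV (\<lambda>k. M * k)"
    using mM finite_multiples_fibre[of M 0] by (intro count_fps_Times) simp_all
  also have "count_fps ?J (\<lambda>j. j * m) = 1 + (\<Sum>j = 2..q - 1. fps_X ^ (j * m))"
    by (simp add: count_fps_finite)
  finally show ?thesis
    unfolding count_fps_multiples[OF mM(1)] count_fps_multiples[OF mM(2)] unfolding m_def M_def .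
qed

text \<open>Here a and b are the inverses of 1 - t and 1 - u. The intended values are u = t^q and s
  = t^2 + ... + t^(q-1), for which the third hypothesis is the telescoped geometric sum.\<close>

lemma hilbert_series_identity:
  fixes a b t u s :: "'b::comm_ring_1"
  assumes "a * (1 - t) = 1" "b * (1 - u) = 1" "(1 - t) * s = t\<^sup>2 - u"
  shows "t * a * b + (1 + s) * b = 1 + t * a + t\<^sup>2 * a + t\<^sup>2 * u * (a * b)"
proof -
  have "t * a * b + (1 + s) * b = t * a * b + (1 + s) * b * (a * (1 - t))"
    by (simp add: assms(1))
  also have "\<dots> = a * b * (t + (1 - t) + (1 - t) * s)"
    by (simp add: algebra_simps)
  also have "\<dots> = a * b * (1 + t\<^sup>2 - u)"
    by (simp add: assms(3) add_diff_eq)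
  \<comment> \<open>This rests on 1 + t^2 - u = (1 - t)(1 - u) + t (1 - u) + t^2 (1 - u) + t^2
    u.\<close>
  also have "\<dots> = (a * (1 - t)) * (b * (1 - u)) + t * a * (b * (1 - u)) + t\<^sup>2 * a * (b * (1 - u))
      + t\<^sup>2 * u * (a * b)"
    by (simp add: algebra_simps)
  finally show ?thesis by (simp add: assms(1,2))
qed

text \<open>The sum telescopes, starting from the empty sum at n = 2, which is the case q =
  2.\<close>

lemma sum_power_from_2:
  fixes t :: "'b::comm_ring_1"
  assumes "2 \<le> n"
  shows "(1 - t) * (\<Sum>j = 2..n - 1. t ^ j) = t\<^sup>2 - t ^ n"
  using assms
proof (induction n rule: dec_induct)
  case (step n)
  then have "{2..Suc n - 1} = insert n {2..n - 1}" by auto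
  then have "(1 - t) * (\<Sum>j = 2..Suc n - 1. t ^ j) = (1 - t) * t ^ n + (1 - t) * (\<Sum>j = 2..n - 1. t ^ j)"
    using step.hyps by (simp add: distrib_left)
  also have "\<dots> = (1 - t) * t ^ n + (t\<^sup>2 - t ^ n)"
    by (simp only: step.IH)
  finally show ?case by (simp add: algebra_simps)
qed (simp add: power2_eq_square)

text \<open>The set of all such combinations is an F_q-subspace containing the classes of the basis
  elements. Since these span every graded piece, it is all of S_B.\<close>

lemma cofixed_generators:
  fixes u :: "'a::finite_field cofixed"
  obtains r s where "u = cofixed_scale r (cofixed_class poly_Y)
      + (\<Sum>j\<in>insert 0 {2..CARD('a) - 1}. cofixed_scale (s j) (cofixed_class (torsion_gen j)))"
proof -
  define J where "J = insert 0 {2..CARD('a) - 1}"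
  define Z where "Z r s = cofixed_scale r (cofixed_class poly_Y)
      + (\<Sum>j\<in>J. cofixed_scale (s j) (cofixed_class (torsion_gen j)))" for r :: "'a inv_ring" and s
  define R where "R = range (\<lambda>(r, s). Z r s)"
  have [simp]: "finite J" by (simp add: J_def)
  have mem: "Z r s \<in> R" for r s by (auto simp: R_def)
  have Abs: "poly_of (Abs_inv_ring p) = p" if "p \<in> invariants" for p :: "'a poly poly"
    using that by (rule Abs_inv_ring_inverse)
  \<comment> \<open>Constants are invariant, so the field acts through S^B and every S^B-combination
    can be rescaled.\<close>
  have const: "cofixed_field_scale c v = cofixed_scale (Abs_inv_ring (const c)) v" for c and v :: "'a cofixed"
  proof (induction v rule: cofixed.abs_induct)
    case (1 f)
    have "const c \<in> invariants" by (simp add: invariants_def)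
    then show ?case by (simp add: Abs flip: cofixed_class_const cofixed_class_poly_of)
  qed
  have subspace: "cofixed_field.subspace R"
    unfolding cofixed_field.subspace_def
  proof (intro conjI ballI allI)
    show "0 \<in> R" using mem[of 0 "\<lambda>_. 0"] by (simp add: Z_def)
  next
    fix v w assume "v \<in> R" "w \<in> R"
    then obtain r s r' s' where "v = Z r s" "w = Z r' s'" by (auto simp: R_def)
    then have "v + w = Z (r + r') (\<lambda>j. s j + s' j)"
      by (simp add: Z_def cofixed.scale_left_distrib sum.distrib)
    then show "v + w \<in> R" by (simp add: mem)
  next
    fix c v assume "v \<in> R"
    then obtain r s where "v = Z r s" by (auto simp: R_def)
    then have "cofixed_field_scale c v = Z (Abs_inv_ring (const c) * r) (\<lambda>j. Abs_inv_ring (const c) * s j)"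
      by (simp add: const Z_def cofixed.scale_right_distrib cofixed.scale_sum_right)
    then show "cofixed_field_scale c v \<in> R" by (simp add: mem)
  qed
  have basis: "cofixed_class (basis_elt x) \<in> R" if x: "x \<in> basis_index CARD('a) d" for x d
  proof (cases x)
    case (Inl p)
    obtain i k where p: "p = (i, k)" by force
    have "poly_X ^ i * poly_D ^ k \<in> (invariants :: 'a poly poly set)"
      using poly_X_invariant[where 'a = 'a] poly_D_invariant[where 'a = 'a]
      by (simp add: invariants_def)
    then have "cofixed_class (basis_elt x) = Z (Abs_inv_ring (poly_X ^ i * poly_D ^ k)) (\<lambda>_. 0)"
      using cofixed_class_poly_of[of "Abs_inv_ring (poly_X ^ i * poly_D ^ k)" "poly_Y :: 'a poly poly"]
      by (simp add: Z_def Inl p basis_elt_def Abs)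
    then show ?thesis by (simp add: mem)
  next
    case (Inr p)
    obtain j k where p: "p = (j, k)" by force
    have "j \<in> J" using x by (auto simp: Inr p basis_index_def J_def Plus_def)
    have "poly_D ^ k \<in> (invariants :: 'a poly poly set)"
      using poly_D_invariant[where 'a = 'a] by (simp add: invariants_def)
    then have "cofixed_class (basis_elt x) =
        cofixed_scale (Abs_inv_ring (poly_D ^ k)) (cofixed_class (torsion_gen j) :: 'a cofixed)"
      using cofixed_class_poly_of[of "Abs_inv_ring (poly_D ^ k)" "torsion_gen j :: 'a poly poly"]
      by (simp add: Inr p basis_elt_def Abs)
    also have "\<dots> = (\<Sum>l\<in>J. if l = j then
        cofixed_scale (Abs_inv_ring (poly_D ^ k)) (cofixed_class (torsion_gen l)) else 0)"
      using \<open>j \<in> J\<close> by simp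
    also have "\<dots> = Z 0 (\<lambda>l. if l = j then Abs_inv_ring (poly_D ^ k) else 0)"
      unfolding Z_def cofixed.scale_zero_left add_0_left by (intro sum.cong) auto
    finally show ?thesis by (simp add: mem)
  qed
  have homog: "cofixed_class f \<in> R" if f: "f \<in> homogeneous d" for f :: "'a poly poly" and d
  proof -
    have "cofixed_field.span (cofixed_class ` basis_elt ` basis_index CARD('a) d) \<subseteq> R"
      by (intro cofixed_field.span_minimal subspace) (auto intro: basis)
    then show ?thesis using homogeneous_in_span_basis[OF f] by blast
  qed
  have "cofixed_class f \<in> R" for f :: "'a poly poly"
  proof -
    have "const c * var_x ^ i * var_y ^ j \<in> homogeneous (0 + 1 * i + 1 * j)" for c :: 'a and i j
      by (intro homogeneous_mult homogeneous_power homogeneous_var_x homogeneous_var_y)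
        (simp add: homogeneous_def coeff2_simps)
    then show ?thesis
      by (subst poly2_as_sum[of f])
        (auto simp only: cofixed_class_sum intro!: cofixed_field.subspace_sum[OF subspace] homog)
  qed
  then have "u \<in> R" by (induction u rule: cofixed.abs_induct) auto
  then show ?thesis by (auto simp: R_def Z_def J_def intro: that)
qed

section \<open>The transfer on the cofixed space and the splitting it induces\<close>

lift_definition cofixed_trace :: "'a::finite_field cofixed \<Rightarrow> 'a poly poly" is borel_trace
  by (metis trace_cofixed_relations trace_simps(3) eq_iff_diff_eq_0)

lemma cofixed_trace_simps [simp]:
  fixes f :: "'a::finite_field poly poly" and u v :: "'a cofixed"
  shows "cofixed_trace (cofixed_class f) = borel_trace f"
  "cofixed_trace (0 :: 'a cofixed) = 0"
  "cofixed_trace (u + v) = cofixed_trace u + cofixed_trace v"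
  "cofixed_trace (cofixed_scale r u) = poly_of r * cofixed_trace u"
proof -
  have *: "cofixed_trace (cofixed_class f) = borel_trace f" for f :: "'a poly poly"
    by (rule cofixed_trace.abs_eq)
  show "cofixed_trace (cofixed_class f) = borel_trace f" by (rule *)
  show "cofixed_trace 0 = (0 :: 'a poly poly)"
    by (simp add: * flip: cofixed_class_simps(3))
  show "cofixed_trace (u + v) = cofixed_trace u + cofixed_trace v"
    by (induction u rule: cofixed.abs_induct, induction v rule: cofixed.abs_induct)
      (simp add: * flip: cofixed_class_simps(1))
  show "cofixed_trace (cofixed_scale r u) = poly_of r * cofixed_trace u"
    by (induction u rule: cofixed.abs_induct)
      (simp add: * trace_invariant_mult poly_of flip: cofixed_class_poly_of)
qed

lemma cofixed_trace_sum:
  "cofixed_trace (\<Sum>i\<in>I. u i) = (\<Sum>i\<in>I. cofixed_trace (u i))"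
  by (induction I rule: infinite_finite_induct) simp_all

lemma cofixed_module_independent:
  fixes r :: "'a::finite_field inv_ring"
  defines "J \<equiv> insert 0 {2..CARD('a) - 1}"
  assumes "cofixed_scale r (cofixed_class poly_Y)
      + (\<Sum>j\<in>J. cofixed_scale (s j) (cofixed_class (torsion_gen j))) = 0"
  shows "r = 0" "\<And>j. j \<in> J \<Longrightarrow> inv_X dvd s j"
proof -
  have rel: "poly_of r * poly_Y + (\<Sum>j\<in>insert 0 {2..CARD('a) - 1}. poly_of (s j) * torsion_gen j)
      \<in> cofixed_relations"
    using assms(2) unfolding J_def
    by (simp only: cofixed_class_simps cofixed_class_sum flip: cofixed_class_poly_of cofixed_class_eq_0_iff)
  note ind = cofixed_relations_module_independent[OF poly_of poly_of rel]
  have "poly_of r = poly_of 0" using ind(1) by (simp add: zero_inv_ring.rep_eq)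
  then show "r = 0" by (simp only: poly_of_inject)
  show "inv_X dvd s j" if j: "j \<in> J" for j
  proof -
    have "at_x0 (poly_of (s j)) = 0" using ind(2) j by (simp add: J_def)
    then obtain p where p: "p \<in> invariants" "poly_of (s j) = poly_X * p"
      using poly_X_dvd_invariant[OF poly_of[of "s j"]] by blast
    then have "poly_of (s j) = poly_of (inv_X * Abs_inv_ring p)"
      by (simp add: times_inv_ring.rep_eq inv_X.rep_eq Abs_inv_ring_inverse)
    then show ?thesis by (simp add: poly_of_inject)
  qed
qed

text \<open>A torsion generator has zero transfer and is therefore killed by X.\<close>

lemma inv_X_scale_torsion_gen:
  assumes "j \<in> insert 0 {2..CARD('a) - 1}" "inv_X dvd r"
  shows "cofixed_scale r (cofixed_class (torsion_gen j)) = (0 :: 'a::finite_field cofixed)"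
proof -
  from assms(2) obtain r' where "r = r' * inv_X" by (metis dvdE mult.commute)
  moreover have "cofixed_scale inv_X (cofixed_class (torsion_gen j)) = (0 :: 'a cofixed)"
    using cofixed_class_poly_X_mult[OF trace_torsion_gen[OF assms(1)]]
    by (simp add: inv_X.rep_eq flip: cofixed_class_poly_of)
  ultimately show ?thesis
    by (simp flip: cofixed.scale_scale)
qed

text \<open>The transfer maps S_B into X S^B and sends r Y to -r X, so it restricts to an
  isomorphism from the span of Y onto X S^B. Its kernel is then a complement of that span.\<close>

lemma cofixed_decomposition:
  "cofixed.independent {cofixed_class poly_Y :: 'a::finite_field cofixed}"
  "bij_betw (\<lambda>(u, v). u + v)
    (cofixed.span {cofixed_class poly_Y} \<times> {v :: 'a cofixed. cofixed_trace v = 0}) UNIV"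
proof -
  have inj: "r = 0" if "poly_of r * poly_X = 0" for r :: "'a inv_ring"
  proof -
    from that have "poly_of r = poly_of 0" by (simp add: poly_X_neq_0 zero_inv_ring.rep_eq)
    then show ?thesis by (simp only: poly_of_inject)
  qed
  have free: "r = 0" if "cofixed_trace (cofixed_scale r (cofixed_class poly_Y)) = 0" for r :: "'a inv_ring"
    using that by (intro inj) (simp add: trace_poly_Y)
  show "cofixed.independent {cofixed_class poly_Y :: 'a cofixed}"
  proof
    assume "cofixed.dependent {cofixed_class poly_Y :: 'a cofixed}"
    then obtain t c where "t \<subseteq> {cofixed_class poly_Y :: 'a cofixed}"
      "(\<Sum>v\<in>t. cofixed_scale (c v) v) = 0" "\<exists>v\<in>t. c v \<noteq> 0"
      unfolding cofixed.dependent_explicit by blast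
    moreover from this have "t = {cofixed_class poly_Y}" by auto
    ultimately show False using free[of "c (cofixed_class poly_Y)"] by auto
  qed
  show "bij_betw (\<lambda>(u, v). u + v)
    (cofixed.span {cofixed_class poly_Y} \<times> {v :: 'a cofixed. cofixed_trace v = 0}) UNIV"
    unfolding bij_betw_def
  proof
    show "inj_on (\<lambda>(u, v). u + v)
      (cofixed.span {cofixed_class poly_Y} \<times> {v :: 'a cofixed. cofixed_trace v = 0})"
    proof (rule inj_onI, clarsimp simp: cofixed.span_singleton)
      fix r r' :: "'a inv_ring" and v v' :: "'a cofixed"
      assume *: "cofixed_trace v = 0" "cofixed_trace v' = 0"
        "cofixed_scale r (cofixed_class poly_Y) + v = cofixed_scale r' (cofixed_class poly_Y) + v'"
      have "cofixed_scale (r - r') (cofixed_class poly_Y) + v = v'"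
        using *(3) by (simp add: cofixed.scale_left_diff_distrib algebra_simps)
      then have "cofixed_trace (cofixed_scale (r - r') (cofixed_class poly_Y)) = 0"
        using *(1,2) by (metis cofixed_trace_simps(3) add_0_right)
      then have "r - r' = 0" by (rule free)
      then have "r = r'" by simp
      with *(3) show "cofixed_scale r (cofixed_class poly_Y) =
          cofixed_scale r' (cofixed_class poly_Y) \<and> v = v'"
        by simp
    qed
    have "w \<in> (\<lambda>(u, v). u + v) `
        (cofixed.span {cofixed_class poly_Y} \<times> {v :: 'a cofixed. cofixed_trace v = 0})" for w
    proof (induction w rule: cofixed.abs_induct)
      case (1 f)
      obtain p where p: "p \<in> invariants" "borel_trace f = poly_X * p"
        using poly_X_dvd_invariant[OF trace_in_invariants at_x0_trace] .
      \<comment> \<open>The transfer of f is X p, and -p Y is the multiple of Y with the same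
        transfer.\<close>
      define u where "u = cofixed_scale (- Abs_inv_ring p) (cofixed_class poly_Y)"
      have span: "u \<in> cofixed.span {cofixed_class poly_Y}"
        unfolding u_def by (intro cofixed.span_scale cofixed.span_base) simp
      have "cofixed_trace u = borel_trace f"
        unfolding u_def
        using p by (simp add: uminus_inv_ring.rep_eq Abs_inv_ring_inverse trace_poly_Y mult.commute
            del: cofixed.scale_minus_left)
      then have "cofixed_trace (cofixed_class f - u) = 0"
        using cofixed_trace_simps(3)[of "cofixed_class f - u" u] by simp
      then show ?case
        by (intro image_eqI[of _ _ "(u, cofixed_class f - u)"]) (auto simp: span)
    qed
    then show "(\<lambda>(u, v). u + v) `
        (cofixed.span {cofixed_class poly_Y} \<times> {v :: 'a cofixed. cofixed_trace v = 0}) = UNIV"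
      by blast
  qed
qed

section \<open>The torsion summand as a sum of copies of S^B/(X)\<close>

definition torsion_hom :: "nat \<Rightarrow> 'a::finite_field inv_mod_X \<Rightarrow> 'a cofixed"
  where "torsion_hom j z = cofixed_scale (rep_inv_mod_X z) (cofixed_class (torsion_gen j))"

text \<open>The arbitrary representative in \<open>torsion_hom\<close> is harmless for generator
  indices: two representatives differ by a multiple of X, which kills the generator.\<close>

lemma torsion_hom_class:
  assumes "j \<in> insert 0 {2..CARD('a) - 1}"
  shows "torsion_hom j (inv_mod_X_class r) =
    cofixed_scale r (cofixed_class (torsion_gen j) :: 'a::finite_field cofixed)"
proof -
  let ?r = "rep_inv_mod_X (inv_mod_X_class r)"
  have "inv_mod_X_class ?r = inv_mod_X_class r"
    by (rule Quotient_abs_rep[OF Quotient_inv_mod_X])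
  then have "inv_X dvd ?r - r" by (simp only: inv_mod_X.abs_eq_iff)
  from inv_X_scale_torsion_gen[OF assms this]
  show ?thesis by (simp add: torsion_hom_def cofixed.scale_left_diff_distrib)
qed

lemma torsion_hom_hom:
  assumes j: "j \<in> insert 0 {2..CARD('a) - 1}"
  shows "module_hom inv_mod_X_scale cofixed_scale (torsion_hom j :: 'a::finite_field inv_mod_X \<Rightarrow> _)"
proof (intro module_hom.intro module_hom_axioms.intro)
  show "module (inv_mod_X_scale :: 'a inv_ring \<Rightarrow> _)" "module (cofixed_scale :: 'a inv_ring \<Rightarrow> _)"
    by unfold_locales
  show "torsion_hom j (z + w) = torsion_hom j z + (torsion_hom j w :: 'a cofixed)" for z w
    by (induction z rule: inv_mod_X.abs_induct, induction w rule: inv_mod_X.abs_induct)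
      (simp add: plus_inv_mod_X.abs_eq torsion_hom_class[OF j] cofixed.scale_left_distrib)
  show "torsion_hom j (inv_mod_X_scale r z) = cofixed_scale r (torsion_hom j z :: 'a cofixed)" for r z
    by (induction z rule: inv_mod_X.abs_induct)
      (simp add: inv_mod_X_scale.abs_eq torsion_hom_class[OF j])
qed

text \<open>If two families have equal sums, independence makes X divide the differences of their
  coefficients, and such differences act as zero. An element with zero transfer, written in the
  generators, has r X = 0 for its coefficient r at Y, so only torsion terms remain.\<close>

lemma torsion_direct_sum:
  "direct_sum (insert 0 {2..CARD('a) - 1}) (\<lambda>j. range (torsion_hom j))
    {v :: 'a::finite_field cofixed. cofixed_trace v = 0}"
proof -
  define J where "J = insert 0 {2..CARD('a) - 1}"
  have fin: "finite J" by (simp add: J_def)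
  let ?t = "\<lambda>j. cofixed_class (torsion_gen j) :: 'a cofixed"
  have range: "range (torsion_hom j) = range (\<lambda>r. cofixed_scale r (?t j))" if "j \<in> J" for j
  proof -
    have surj: "(UNIV :: 'a inv_mod_X set) = range inv_mod_X_class"
    proof -
      have "z \<in> range inv_mod_X_class" for z :: "'a inv_mod_X"
        by (induction z rule: inv_mod_X.abs_induct) blast
      then show ?thesis by blast
    qed
    have "range (torsion_hom j) = torsion_hom j ` range (inv_mod_X_class :: 'a inv_ring \<Rightarrow> _)"
      by (rule arg_cong[OF surj])
    then show ?thesis
      using that by (simp add: image_image torsion_hom_class J_def)
  qed
  have tr0: "cofixed_trace (cofixed_scale r (?t j)) = 0" if "j \<in> J" for r j
    using that by (simp add: trace_torsion_gen J_def)
  have "bij_betw (\<lambda>u. \<Sum>j\<in>J. u j) (\<Pi>\<^sub>E j\<in>J. range (torsion_hom j))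
      {v :: 'a cofixed. cofixed_trace v = 0}"
    unfolding bij_betw_def
  proof
    show "inj_on (\<lambda>u. \<Sum>j\<in>J. u j) (\<Pi>\<^sub>E j\<in>J. range (torsion_hom j :: _ \<Rightarrow> 'a cofixed))"
    proof (rule inj_onI)
      fix u v :: "nat \<Rightarrow> 'a cofixed"
      assume u: "u \<in> (\<Pi>\<^sub>E j\<in>J. range (torsion_hom j))" and v: "v \<in> (\<Pi>\<^sub>E j\<in>J. range (torsion_hom j))"
        and eq: "(\<Sum>j\<in>J. u j) = (\<Sum>j\<in>J. v j)"
      have "\<exists>r. u j = cofixed_scale r (?t j)" "\<exists>r. v j = cofixed_scale r (?t j)" if "j \<in> J" for j
        using u v range[OF that] that by (auto dest!: PiE_mem[of _ _ _ j])
      then obtain r s where rs: "\<And>j. j \<in> J \<Longrightarrow> u j = cofixed_scale (r j) (?t j)"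
        "\<And>j. j \<in> J \<Longrightarrow> v j = cofixed_scale (s j) (?t j)"
        by metis
      have "(\<Sum>j\<in>J. cofixed_scale (r j - s j) (?t j)) = 0"
        using eq by (simp add: rs cofixed.scale_left_diff_distrib sum_subtractf)
      then have "inv_X dvd r j - s j" if "j \<in> J" for j
        using cofixed_module_independent(2)[of 0 "\<lambda>j. r j - s j" j] that by (simp add: J_def)
      then have "cofixed_scale (r j - s j) (?t j) = 0" if "j \<in> J" for j
        using that by (intro inv_X_scale_torsion_gen) (auto simp: J_def)
      then have "u j = v j" if "j \<in> J" for j
        using that rs by (simp add: cofixed.scale_left_diff_distrib)
      then show "u = v" using u v by (rule PiE_ext[rotated 2])
    qed
    show "(\<lambda>u. \<Sum>j\<in>J. u j) ` (\<Pi>\<^sub>E j\<in>J. range (torsion_hom j)) = {v :: 'a cofixed. cofixed_trace v = 0}"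
    proof (intro equalityI subsetI)
      fix v :: "'a cofixed" assume "v \<in> (\<lambda>u. \<Sum>j\<in>J. u j) ` (\<Pi>\<^sub>E j\<in>J. range (torsion_hom j))"
      then obtain u where u: "v = (\<Sum>j\<in>J. u j)" "u \<in> (\<Pi>\<^sub>E j\<in>J. range (torsion_hom j))" by blast
      have "cofixed_trace (u j) = 0" if "j \<in> J" for j
        using PiE_mem[OF u(2) that] range[OF that] tr0[OF that] by auto
      then show "v \<in> {v. cofixed_trace v = 0}" by (simp add: u(1) cofixed_trace_sum)
    next
      fix v :: "'a cofixed" assume v: "v \<in> {v. cofixed_trace v = 0}"
      obtain r s where rs: "v = cofixed_scale r (cofixed_class poly_Y) + (\<Sum>j\<in>J. cofixed_scale (s j) (?t j))"
        using cofixed_generators[of v] unfolding J_def by blast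
      have "cofixed_trace (\<Sum>j\<in>J. cofixed_scale (s j) (?t j)) = 0"
        unfolding cofixed_trace_sum by (intro sum.neutral ballI tr0)
      then have tr: "cofixed_trace (cofixed_scale r (cofixed_class poly_Y :: 'a cofixed)) = 0"
        using v rs by (metis (mono_tags, lifting) add_0_right cofixed_trace_simps(3) mem_Collect_eq)
      then have "poly_of r = poly_of 0"
        by (simp add: trace_poly_Y poly_X_neq_0 zero_inv_ring.rep_eq)
      then have "r = 0" by (simp only: poly_of_inject)
      then have "v = (\<Sum>j\<in>J. restrict (\<lambda>j. cofixed_scale (s j) (?t j)) J j)"
        by (simp add: rs)
      moreover have "restrict (\<lambda>j. cofixed_scale (s j) (?t j)) J \<in> (\<Pi>\<^sub>E j\<in>J. range (torsion_hom j))"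
        using range by (auto simp: restrict_PiE_iff)
      ultimately show "v \<in> (\<lambda>u. \<Sum>j\<in>J. u j) ` (\<Pi>\<^sub>E j\<in>J. range (torsion_hom j))" by blast
    qed
  qed
  with fin show ?thesis by (simp add: direct_sum_def J_def)
qed

text \<open>Module independence is applied to the family whose only nonzero coefficient, r - s,
  stands at j.\<close>

lemma inj_torsion_hom:
  assumes j: "j \<in> insert 0 {2..CARD('a) - 1}"
  shows "inj (torsion_hom j :: 'a::finite_field inv_mod_X \<Rightarrow> _)"
proof (rule injI)
  fix z w :: "'a inv_mod_X"
  assume eq: "torsion_hom j z = torsion_hom j w"
  obtain r where r: "z = inv_mod_X_class r" by (induction z rule: inv_mod_X.abs_induct) blast
  obtain s where s: "w = inv_mod_X_class s" by (induction w rule: inv_mod_X.abs_induct) blast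
  let ?t = "\<lambda>j. cofixed_class (torsion_gen j) :: 'a cofixed"
  have "cofixed_scale (r - s) (?t j) = 0"
    using eq by (simp add: r s torsion_hom_class[OF j] cofixed.scale_left_diff_distrib)
  moreover have "(\<Sum>i\<in>insert 0 {2..CARD('a) - 1}. cofixed_scale (if i = j then r - s else 0) (?t i)) =
      (\<Sum>i\<in>insert 0 {2..CARD('a) - 1}. if i = j then cofixed_scale (r - s) (?t i) else 0)"
    by (rule sum.cong) auto
  ultimately have "(\<Sum>i\<in>insert 0 {2..CARD('a) - 1}. cofixed_scale (if i = j then r - s else 0) (?t i)) = 0"
    by (simp add: sum.delta del: sum.insert)
  then have "inv_X dvd r - s"
    using cofixed_module_independent(2)[of 0 "\<lambda>i. if i = j then r - s else 0" j] j by simp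
  then show "z = w" by (simp only: r s inv_mod_X.abs_eq_iff)
qed

text \<open>The first conjunct identifies the invariants underlying \<open>inv_ring\<close> with the
  polynomial ring in D and X, so that modules over \<open>inv_ring\<close> are modules over
  F_q[D, X].\<close>

theorem theoremB10:
  fixes q :: nat
  assumes q: "q = CARD('a::finite_field)"
  shows
    "bij_betw (subst2 poly_D poly_X) (UNIV :: 'a poly poly set) invariants \<and>
     (\<exists>M1 M2 :: 'a cofixed set.
       cofixed.subspace M1 \<and> cofixed.subspace M2 \<and>
       bij_betw (\<lambda>(u, v). u + v) (M1 \<times> M2) UNIV \<and>
       cofixed.independent {cofixed_class poly_Y} \<and>
       cofixed.span {cofixed_class poly_Y} = M1 \<and>
       (\<exists>\<phi> :: nat \<Rightarrow> 'a inv_mod_X \<Rightarrow> 'a cofixed.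
          (\<forall>j \<in> insert 0 {2..q - 1}.
             module_hom inv_mod_X_scale cofixed_scale (\<phi> j) \<and> inj (\<phi> j) \<and>
             \<phi> j (inv_mod_X_class 1) = cofixed_class (torsion_gen j)) \<and>
          direct_sum (insert 0 {2..q - 1}) (\<lambda>j. range (\<phi> j)) M2)) \<and>
     Hilb (cofixed_piece :: nat \<Rightarrow> 'a cofixed set) =
       fps_X ^ (q - 1) / ((1 - fps_X ^ (q - 1)) * (1 - fps_X ^ (q\<^sup>2 - q)))
       + (1 + (\<Sum>j = 2..q - 1. fps_X ^ (j * (q - 1)))) / (1 - fps_X ^ (q\<^sup>2 - q)) \<and>
     Hilb (cofixed_piece :: nat \<Rightarrow> 'a cofixed set) =
       1 + fps_X ^ (q - 1) / (1 - fps_X ^ (q - 1))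
       + fps_X ^ (2 * (q - 1)) / (1 - fps_X ^ (q - 1))
       + fps_X ^ (q\<^sup>2 + q - 2) / ((1 - fps_X ^ (q - 1)) * (1 - fps_X ^ (q\<^sup>2 - q)))"
proof (intro conjI)
  show "bij_betw (subst2 poly_D poly_X) (UNIV :: 'a poly poly set) invariants"
    by (simp add: bij_betw_def inj_subst2_poly_D_poly_X range_subst2_poly_D_poly_X)
  let ?M1 = "cofixed.span {cofixed_class poly_Y :: 'a cofixed}"
  \<comment> \<open>The torsion summand is taken to be the kernel of the transfer.\<close>
  let ?M2 = "{v :: 'a cofixed. cofixed_trace v = 0}"
  have subspace: "cofixed.subspace ?M2" by (simp add: cofixed.subspace_def)
  show "\<exists>M1 M2 :: 'a cofixed set.
       cofixed.subspace M1 \<and> cofixed.subspace M2 \<and>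
       bij_betw (\<lambda>(u, v). u + v) (M1 \<times> M2) UNIV \<and>
       cofixed.independent {cofixed_class poly_Y} \<and>
       cofixed.span {cofixed_class poly_Y} = M1 \<and>
       (\<exists>\<phi> :: nat \<Rightarrow> 'a inv_mod_X \<Rightarrow> 'a cofixed.
          (\<forall>j \<in> insert 0 {2..q - 1}.
             module_hom inv_mod_X_scale cofixed_scale (\<phi> j) \<and> inj (\<phi> j) \<and>
             \<phi> j (inv_mod_X_class 1) = cofixed_class (torsion_gen j)) \<and>
          direct_sum (insert 0 {2..q - 1}) (\<lambda>j. range (\<phi> j)) M2)"
    unfolding q
    by (rule exI[of _ ?M1], rule exI[of _ ?M2], intro exI[of _ torsion_hom] conjI ballI)
      (simp_all only: subspace cofixed_decomposition cofixed.subspace_span torsion_direct_sum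
        torsion_hom_hom inj_torsion_hom torsion_hom_class cofixed.scale_one not_False_eq_True)
  have q1: "1 < q" unfolding q by (rule one_less_card_field)
  define t :: "rat fps" where "t = fps_X ^ (q - 1)"
  define a where "a = inverse (1 - t)"
  define b where "b = inverse (1 - t ^ q)"
  have nz: "fps_nth (1 - t) 0 \<noteq> 0" "fps_nth (1 - t ^ q) 0 \<noteq> 0"
    using q1 by (simp_all add: t_def fps_X_power_nth flip: power_mult)
  \<comment> \<open>All exponents in both series are multiples of q - 1, so both become rational
    expressions in t.\<close>
  have e1: "q\<^sup>2 - q = (q - 1) * q" by (simp add: power2_eq_square diff_mult_distrib)
  have e2: "q\<^sup>2 + q - 2 = (q - 1) * (2 + q)"
    using q1 by (simp add: power2_eq_square algebra_simps)
  have pow: "fps_X ^ (q\<^sup>2 - q) = t ^ q" "fps_X ^ (q\<^sup>2 + q - 2) = t\<^sup>2 * t ^ q"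
    "fps_X ^ (2 * (q - 1)) = t\<^sup>2" "fps_X ^ (j * (q - 1)) = t ^ j" "fps_X ^ (q - 1) = t" for j
    unfolding e1 e2 t_def power_mult power_add by (simp_all flip: power_mult add: mult.commute)
  \<comment> \<open>The denominators have nonzero constant term, so division of power series is
    multiplication by the inverse.\<close>
  have div: "f / (1 - t) = f * a" "f / (1 - t ^ q) = f * b" "f / ((1 - t) * (1 - t ^ q)) = f * (a * b)" for f
    using nz by (simp_all add: a_def b_def fps_divide_unit fps_inverse_mult)
  have H: "Hilb (cofixed_piece :: nat \<Rightarrow> 'a cofixed set) = t * a * b + (1 + (\<Sum>j = 2..q - 1. t ^ j)) * b"
    using Hilb_cofixed_piece[where 'a = 'a] by (simp only: pow a_def b_def flip: q)
  then show "Hilb (cofixed_piece :: nat \<Rightarrow> 'a cofixed set) =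
       fps_X ^ (q - 1) / ((1 - fps_X ^ (q - 1)) * (1 - fps_X ^ (q\<^sup>2 - q)))
       + (1 + (\<Sum>j = 2..q - 1. fps_X ^ (j * (q - 1)))) / (1 - fps_X ^ (q\<^sup>2 - q))"
    by (simp only: pow div mult.assoc)
  have "a * (1 - t) = 1" "b * (1 - t ^ q) = 1"
    using nz by (simp_all add: a_def b_def inverse_mult_eq_1)
  from hilbert_series_identity[OF this sum_power_from_2] q1 H
  show "Hilb (cofixed_piece :: nat \<Rightarrow> 'a cofixed set) =
       1 + fps_X ^ (q - 1) / (1 - fps_X ^ (q - 1))
       + fps_X ^ (2 * (q - 1)) / (1 - fps_X ^ (q - 1))
       + fps_X ^ (q\<^sup>2 + q - 2) / ((1 - fps_X ^ (q - 1)) * (1 - fps_X ^ (q\<^sup>2 - q)))"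
    by (simp only: pow div)
qed

end
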